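(* Let $d,n\ge 1$, let $b>0$, let $A\in\mathbb{M}_d$ be a fixed matrix, and let $\{X_1,\dots,X_n\}\subset\mathbb{M}_d$ be an independent family of random matrices satisfying, for each $i=1,\dots,n$, $$\mathbb{E}X_i=A\quad\text{and}\quad \|X_i-\mathbb{E}X_i\|^2\le b^2\ \text{ almost surely}.$$ Put $\mu:=\|A\|$ and $$Z_n=\Big(I+\frac{X_n}{n}\Big)\cdots\Big(I+\frac{X_1}{n}\Big).$$ Then $$\mathbb{P}\{\|Z_n\|\ge(1+s)\,e^{\mu}\}\le d\cdot\exp\Big(\frac{-n\log^2(1+s)}{2b^2}\Big)\quad\text{whenever } \log(1+s)\ge 2b^2/n,$$ and $$\mathbb{P}\{\|Z_n-\mathbb{E}Z_n\|\ge t\,e^{\mu}\}\le (d+e)\cdot\exp\Big(\frac{-nt^2}{2e^2b^2}\Big)\quad\text{whenever } 0\le t\le e.$$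
   Context: $\mathbb{M}_d$ is the algebra of $d\times d$ complex matrices, $I$ is the identity matrix, and $\|\cdot\|$ is the spectral norm ($\ell_2$ operator norm). $e$ is Euler's number, and $\log^2 x$ means $(\log x)^2$. *)

theory Defs
  imports "HOL-Probability.Probability"
begin

text \<open>
  The norm of \<^typ>\<open>complex ^ 'd\<close> is the Euclidean norm, so the operator norm below is the
  spectral norm.  The norm that the type class provides on \<^typ>\<open>complex ^ 'd ^ 'd\<close> itself is
  the Frobenius norm and is not used.
\<close>

definition spectral_norm :: "complex ^ 'd ^ 'd \<Rightarrow> real" where
  "spectral_norm A = onorm (\<lambda>x. A *v x)"

text \<open>\<open>left_prod Y k\<close> is \<open>Y k ** \<dots> ** Y 1\<close>: later factors multiply from the left.\<close>

primrec left_prod :: "(nat \<Rightarrow> complex ^ 'd ^ 'd) \<Rightarrow> nat \<Rightarrow> complex ^ 'd ^ 'd" where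
  "left_prod Y 0 = mat 1"
| "left_prod Y (Suc k) = Y (Suc k) ** left_prod Y k"

definition perturbed_prod ::
    "(nat \<Rightarrow> 'w \<Rightarrow> complex ^ 'd ^ 'd) \<Rightarrow> nat \<Rightarrow> 'w \<Rightarrow> complex ^ 'd ^ 'd" where
  "perturbed_prod X n \<omega> = left_prod (\<lambda>i. mat 1 + X i \<omega> /\<^sub>R real n) n"

end

theory Submission
  imports Defs
begin

text \<open>
  For an even exponent \<open>q = 2 p\<close>, the Schatten moment \<open>E tr ((W W\<^sup>*)\<^sup>p)\<close> of a random matrix is the
  expected trace of the alternating word \<open>W W\<^sup>* W W\<^sup>* \<dots>\<close> of length \<open>q\<close>; write \<open>s W\<close> for its
  \<open>q\<close>-th root.  Reflecting words by the Cauchy--Schwarz inequality (a chessboard estimate) gives the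
  Hoelder inequality for the expected trace of any word of length \<open>q\<close>.  Expanding words, it turns
  the scalar two-point inequality into
  \<open>s (X + Y)\<^sup>2 + s (X - Y)\<^sup>2 \<le> 2 (s X)\<^sup>2 + 2 (q - 1) (s Y)\<^sup>2\<close>, so that
  \<open>t \<mapsto> s (X + t Y)\<^sup>2 - (q - 1) t\<^sup>2 (s Y)\<^sup>2\<close> is midpoint concave.  If \<open>Y\<close> has mean zero given \<open>X\<close>,
  then \<open>s (X + t Y)\<close> is least at \<open>t = 0\<close>, and concavity gives the uniform smoothness
  \<open>s (X + Y)\<^sup>2 \<le> (s X)\<^sup>2 + (q - 1) (s Y)\<^sup>2\<close>.

  Applied to one factor of the product at a time, this yields recursions for the moments of \<open>Z\<^sub>k\<close> and
  \<open>Z\<^sub>k - E Z\<^sub>k\<close>, and Markov's inequality gives the tail bounds.  Even exponents suffice: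
  rounding the optimal \<open>q\<close> up to an even integer is paid for by the difference between
  \<open>q (q - 1)\<close> and \<open>q\<^sup>2\<close> in the first bound and between \<open>e\<^sup>x - 1\<close> and \<open>e x\<close> in the second.
\<close>

section \<open>Alternating words and the chessboard estimate\<close>

text \<open>The involution \<open>st\<close> is left abstract because two are used:
  \<open>fadj\<close> on random matrices, and \<open>map_prod fadj fadj\<close> on pairs of
  them.\<close>

definition alternating :: "('a \<Rightarrow> 'a) \<Rightarrow> nat \<Rightarrow> 'a \<Rightarrow> 'a list" where
  "alternating st n a = map (\<lambda>i. if even i then a else st a) [0..<n]"

lemma length_alternating [simp]: "length (alternating st n a) = n"
  by (simp add: alternating_def)

lemma nth_alternating: "i < n \<Longrightarrow> alternating st n a ! i = (if even i then a else st a)"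
  by (simp add: alternating_def)

lemma set_alternating_subset: "set (alternating st n a) \<subseteq> {a, st a}"
  by (auto simp: alternating_def)

lemma take_alternating: "m \<le> n \<Longrightarrow> take m (alternating st n a) = alternating st m a"
  by (simp add: alternating_def take_map)

lemma alternating_Suc:
  assumes "st (st a) = a"
  shows "alternating st (Suc n) a = a # alternating st n (st a)"
  by (rule nth_equalityI) (auto simp: nth_alternating nth_Cons assms split: nat.splits)

text \<open>At the junction \<open>st a\<close> meets \<open>a\<close>, so the alternation runs on
  across it. The new first letter is \<open>st\<close> of the old last letter, which explains the
  dependence on the parity of \<open>r\<close>.\<close>

lemma alternating_reflect:
  assumes "st (st a) = a"
  shows "rev (map st (alternating st r a)) @ alternating st r a =
           alternating st (2 * r) (if even r then a else st a)"
proof (rule nth_equalityI)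
  fix i assume i: "i < length (rev (map st (alternating st r a)) @ alternating st r a)"
  show "(rev (map st (alternating st r a)) @ alternating st r a) ! i =
          alternating st (2 * r) (if even r then a else st a) ! i"
  proof (cases "i < r")
    case True
    then have "even (r - Suc i) \<longleftrightarrow> (even r \<noteq> even i)"
      by auto
    with True show ?thesis
      by (auto simp: nth_append rev_nth nth_alternating assms)
  next
    case False
    then have "even (i - r) \<longleftrightarrow> (even r = even i)"
      by auto
    with False i show ?thesis
      by (auto simp: nth_append nth_alternating assms)
  qed
qed simp

text \<open>
  A maximal word of length \<open>2 p\<close> stays maximal when its second half is replaced by the reflection of
  its first half, and each reflection doubles the length of an alternating prefix.
\<close>

lemma chessboard_le_one:
  fixes \<phi> :: "'a list \<Rightarrow> real"
  assumes fin: "finite L"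
    and st: "\<And>a. a \<in> L \<Longrightarrow> st a \<in> L" "\<And>a. a \<in> L \<Longrightarrow> st (st a) = a"
    and cyc: "\<And>u v. set u \<subseteq> L \<Longrightarrow> set v \<subseteq> L \<Longrightarrow> \<phi> (u @ v) = \<phi> (v @ u)"
    and refl: "\<And>u v. set u \<subseteq> L \<Longrightarrow> set v \<subseteq> L \<Longrightarrow>
        \<phi> (u @ v) \<le> (\<phi> (rev (map st u) @ u) + \<phi> (v @ rev (map st v))) / 2"
    and alt: "\<And>a. a \<in> L \<Longrightarrow> \<phi> (alternating st (2 * p) a) \<le> 1"
    and w: "set w \<subseteq> L" "length w = 2 * p" and p: "0 < p"
  shows "\<phi> w \<le> 1"
proof -
  define W where "W = {w. set w \<subseteq> L \<and> length w = 2 * p}"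
  have finW: "finite W" unfolding W_def by (rule finite_lists_length_eq[OF fin])
  have wW: "w \<in> W" using w by (simp add: W_def)
  define m where "m = Max (\<phi> ` W)"
  have le_m: "\<phi> x \<le> m" if "x \<in> W" for x
    using finW that by (simp add: m_def)
  have "m \<in> \<phi> ` W" unfolding m_def using finW wW by (intro Max_in) auto
  then obtain x0 where x0: "x0 \<in> W" "\<phi> x0 = m" by blast
  have stset: "set (rev (map st u)) \<subseteq> L" if "set u \<subseteq> L" for u
    using that st by auto
  \<comment> \<open>A maximal word with an alternating prefix of length \<open>r\<close> is replaced
    by one with a longer such prefix, until the prefix fills the first half.\<close>
  have key: "m \<le> 1" if "x \<in> W" "\<phi> x = m" "a \<in> L" "take r x = alternating st r a" "1 \<le> r" "r \<le> p"
    for x a r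
    using that
  proof (induction "p - r" arbitrary: x a r rule: less_induct)
    case less
    define u v where "u = take p x" and "v = drop p x"
    have xuv: "x = u @ v" by (simp add: u_def v_def)
    have uL: "set u \<subseteq> L" and vL: "set v \<subseteq> L" and lu: "length u = p" and lv: "length v = p"
      using less.prems(1) by (auto simp: W_def u_def v_def dest: in_set_takeD in_set_dropD)
    \<comment> \<open>Both reflections are at most \<open>m\<close>, while their average is at least
      \<open>\<phi> x = m\<close>; hence the reflection of \<open>u\<close> attains \<open>m\<close>
      as well.\<close>
    have "\<phi> (v @ rev (map st v)) \<le> m"
      by (rule le_m) (use vL lv stset[OF vL] in \<open>auto simp: W_def\<close>)
    moreover have inW: "rev (map st u) @ u \<in> W"
      using uL lu stset[OF uL] by (auto simp: W_def)
    ultimately have um: "\<phi> (rev (map st u) @ u) = m"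
      using refl[OF uL vL] less.prems(2) le_m[OF inW] by (simp add: xuv[symmetric])
    have aa: "st (st a) = a" using st less.prems(3) by auto
    let ?c = "if even r then a else st a"
    have cL: "?c \<in> L" using st less.prems(3) by auto
    show ?case
    proof (cases "r = p")
      case True
      then have "u = alternating st p a" using less.prems(4) by (simp add: u_def)
      then show ?thesis using um alternating_reflect[of st a, OF aa] alt[OF cL] True by simp
    next
      case False
      \<comment> \<open>In the reflected word the alternating prefix of \<open>u\<close> and its
        mirror image are adjacent in the middle. A cyclic shift brings this block of length
        \<open>2 * r\<close> to the front, giving \<open>?y\<close>.\<close>
      define s where "s = drop r u"
      have u: "u = alternating st r a @ s"
        using less.prems(4,6) by (metis append_take_drop_id min.absorb1 s_def take_take u_def)
      have sL: "set s \<subseteq> L" using uL u by auto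
      have altL: "set (alternating st k a') \<subseteq> L" if "a' \<in> L" for a' k
        using set_alternating_subset[of st k a'] that st by auto
      let ?y = "alternating st (2 * r) ?c @ s @ rev (map st s)"
      have "rev (map st u) @ u = rev (map st s) @ (alternating st (2 * r) ?c @ s)"
        unfolding u map_append rev_append append_assoc alternating_reflect[of st a r, OF aa, symmetric] ..
      then have y: "\<phi> ?y = m"
        using cyc[of "rev (map st s)" "alternating st (2 * r) ?c @ s"] um
          stset[OF sL] sL altL[OF cL] by simp
      have "length s = p - r" by (simp add: s_def lu)
      then have "length ?y = 2 * p" using less.prems(6) by simp
      moreover have "set ?y \<subseteq> L"
        using stset[OF sL] sL altL[OF cL, of "2 * r"] unfolding set_append by blast
      ultimately have yW: "?y \<in> W"
        unfolding W_def by blast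
      \<comment> \<open>Capping at \<open>p\<close> makes the iteration land exactly on the terminal
        case \<open>r = p\<close>.\<close>
      let ?r = "min (2 * r) p"
      have "take ?r ?y = alternating st ?r ?c"
        by (simp add: take_alternating)
      moreover have "p - ?r < p - r" "1 \<le> ?r" "?r \<le> p"
        using less.prems(5,6) False by auto
      ultimately show ?thesis
        by (intro less.hyps[of ?r ?y ?c] y yW cL)
    qed
  qed
  \<comment> \<open>Every nonempty word has an alternating prefix of length 1, which starts the
    doubling.\<close>
  have "take 1 x0 = alternating st 1 (hd x0)"
    using x0 p by (cases x0) (auto simp: W_def alternating_def)
  moreover have "hd x0 \<in> L" using x0 p by (cases x0) (auto simp: W_def)
  ultimately have "m \<le> 1" using key[OF x0, of "hd x0" 1] p by simp
  then show ?thesis using le_m[OF wW] by simp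
qed

section \<open>Complex matrices\<close>

definition adj :: "complex ^ 'n ^ 'm \<Rightarrow> complex ^ 'm ^ 'n" where
  "adj A = (\<chi> i j. cnj (A $ j $ i))"

lemma adj_adj [simp]: "adj (adj A) = A"
  by (simp add: adj_def vec_eq_iff)

lemma adj_mult: "adj (A ** B) = adj B ** adj A"
  by (simp add: adj_def vec_eq_iff matrix_matrix_mult_def mult.commute)

lemma adj_add: "adj (A + B) = adj A + adj B"
  by (simp add: adj_def vec_eq_iff)

lemma adj_scaleR: "adj (r *\<^sub>R A) = r *\<^sub>R adj A"
  by (simp add: adj_def vec_eq_iff)

lemma adj_mat_1 [simp]: "adj (mat 1) = mat 1"
  by (simp add: adj_def vec_eq_iff mat_def)

lemma norm_adj [simp]: "norm (adj A) = norm A"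
proof -
  have "adj A \<bullet> adj A = A \<bullet> A"
    unfolding adj_def inner_vec_def by (subst sum.swap) (simp add: inner_complex_def)
  then show ?thesis by (simp add: norm_eq_sqrt_inner)
qed

lemma bounded_linear_adj: "bounded_linear adj"
  by (simp add: linear_conv_bounded_linear[symmetric] linear_iff adj_add adj_scaleR)

lemma matrix_mult_scaleR_left: "((r::real) *\<^sub>R A) ** B = r *\<^sub>R (A ** B)" for A :: "complex ^ 'n ^ 'm"
  by (simp add: matrix_matrix_mult_def vec_eq_iff scaleR_sum_right)

lemma matrix_mult_scaleR_right: "A ** ((r::real) *\<^sub>R B) = r *\<^sub>R (A ** B)" for A :: "complex ^ 'n ^ 'm"
  by (simp add: matrix_matrix_mult_def vec_eq_iff scaleR_sum_right)

lemma matrix_mult_add_rdistrib: "(A + B) ** C = A ** C + B ** C" for A :: "complex ^ 'n ^ 'm"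
  by (simp add: matrix_matrix_mult_def vec_eq_iff distrib_right sum.distrib)

lemma bounded_bilinear_matrix_mult:
  "bounded_bilinear ((**) :: complex ^ 'n ^ 'm \<Rightarrow> complex ^ 'k ^ 'n \<Rightarrow> complex ^ 'k ^ 'm)"
proof -
  have "bilinear ((**) :: complex ^ 'n ^ 'm \<Rightarrow> complex ^ 'k ^ 'n \<Rightarrow> complex ^ 'k ^ 'm)"
    by (simp add: bilinear_def linear_iff matrix_add_ldistrib matrix_mult_add_rdistrib
        matrix_mult_scaleR_left matrix_mult_scaleR_right)
  then show ?thesis by (simp only: bilinear_conv_bounded_bilinear)
qed

section \<open>The real trace and the Frobenius inner product\<close>

definition re_trace :: "complex ^ 'n ^ 'n \<Rightarrow> real" where
  "re_trace A = Re (trace A)"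

lemma re_trace_mult_commute: "re_trace (A ** B) = re_trace (B ** A)"
  unfolding re_trace_def by (rule arg_cong[OF trace_mul_sym])

text \<open>The real part of the Hilbert-Schmidt pairing is the Euclidean inner product of the
  entries. This turns traces of words into inner products and squared Frobenius norms, to which
  Cauchy-Schwarz applies.\<close>

lemma re_trace_adj_mult: "re_trace (adj A ** B) = A \<bullet> B"
proof -
  have "re_trace (adj A ** B) = (\<Sum>i\<in>UNIV. \<Sum>k\<in>UNIV. A $ k $ i \<bullet> B $ k $ i)"
    by (simp add: re_trace_def trace_def matrix_matrix_mult_def adj_def inner_complex_def)
  also have "\<dots> = A \<bullet> B"
    unfolding inner_vec_def by (rule sum.swap)
  finally show ?thesis .
qed

lemma bounded_linear_re_trace: "bounded_linear re_trace"
proof -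
  have "linear (re_trace :: complex ^ 'n ^ 'n \<Rightarrow> real)"
    by (rule linearI) (simp_all add: re_trace_def trace_def sum.distrib sum_distrib_left)
  then show ?thesis by (simp only: linear_conv_bounded_linear)
qed

lemma re_trace_mat_1: "re_trace (mat 1 :: complex ^ 'n ^ 'n) = real CARD('n)"
  by (simp add: re_trace_def trace_def mat_def)

section \<open>The spectral norm\<close>

lemma bounded_linear_matrix_vector_mult: "bounded_linear (\<lambda>x. (A :: complex ^ 'n ^ 'm) *v x)"
  by (simp add: linear_conv_bounded_linear[symmetric] linear_iff matrix_vector_right_distrib)
     (simp add: matrix_vector_mult_def vec_eq_iff scaleR_sum_right)

lemma spectral_norm_nonneg: "0 \<le> spectral_norm A"
  unfolding spectral_norm_def by (rule onorm_pos_le[OF bounded_linear_matrix_vector_mult])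

lemma norm_matrix_vector_le: "norm (A *v x) \<le> spectral_norm A * norm x"
  unfolding spectral_norm_def by (rule onorm[OF bounded_linear_matrix_vector_mult])

lemma spectral_norm_scaleR: "spectral_norm (r *\<^sub>R A) = \<bar>r\<bar> * spectral_norm A"
proof -
  have "(\<lambda>x. (r *\<^sub>R A) *v x) = (\<lambda>x. r *\<^sub>R (A *v x))"
    by (simp add: matrix_vector_mult_def vec_eq_iff scaleR_sum_right fun_eq_iff)
  then show ?thesis
    unfolding spectral_norm_def
    by (simp add: onorm_scaleR[OF bounded_linear_matrix_vector_mult])
qed

lemma spectral_norm_mat_1_le: "spectral_norm (mat 1) \<le> 1"
  unfolding spectral_norm_def by (rule onorm_le) simp

lemma spectral_norm_triangle: "spectral_norm (A + B) \<le> spectral_norm A + spectral_norm B"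
  using onorm_triangle[OF bounded_linear_matrix_vector_mult[of A] bounded_linear_matrix_vector_mult[of B]]
  by (simp add: spectral_norm_def matrix_vector_mult_add_rdistrib)

text \<open>\<open>B\<close> acts on each column of \<open>C\<close> separately, and the squared
  Frobenius norm is the sum of the squared norms of the columns.\<close>

lemma norm_matrix_mult_le:
  fixes B :: "complex ^ 'n ^ 'n" and C :: "complex ^ 'm ^ 'n"
  shows "norm (B ** C) \<le> spectral_norm B * norm C"
proof -
  have col: "(norm D)\<^sup>2 = (\<Sum>j\<in>UNIV. (norm (column j D))\<^sup>2)" for D :: "complex ^ 'm ^ 'n"
  proof -
    have "D \<bullet> D = (\<Sum>j\<in>UNIV. column j D \<bullet> column j D)"
      unfolding inner_vec_def column_def by (subst sum.swap) simp
    then show ?thesis unfolding power2_norm_eq_inner .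
  qed
  have c: "column j (B ** C) = B *v column j C" for j
    by (simp add: column_def matrix_matrix_mult_def matrix_vector_mult_def vec_eq_iff)
  have "(norm (B ** C))\<^sup>2 \<le> (\<Sum>j\<in>UNIV. (spectral_norm B * norm (column j C))\<^sup>2)"
    unfolding col c by (intro sum_mono power_mono norm_matrix_vector_le) simp
  also have "\<dots> = (spectral_norm B * norm C)\<^sup>2"
    unfolding power_mult_distrib col sum_distrib_left ..
  finally show ?thesis
    by (rule power2_le_imp_le) (simp add: spectral_norm_nonneg)
qed

section \<open>Words in random matrices and their adjoints\<close>

definition mprod :: "('w \<Rightarrow> complex ^ 'n ^ 'n) list \<Rightarrow> 'w \<Rightarrow> complex ^ 'n ^ 'n" where
  "mprod Ws \<omega> = foldr (\<lambda>W P. W \<omega> ** P) Ws (mat 1)"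

definition fadj :: "('w \<Rightarrow> complex ^ 'n ^ 'm) \<Rightarrow> 'w \<Rightarrow> complex ^ 'm ^ 'n" where
  "fadj W \<omega> = adj (W \<omega>)"

lemma fadj_fadj [simp]: "fadj (fadj W) = W"
  by (simp add: fadj_def fun_eq_iff)

lemma mprod_Nil [simp]: "mprod [] \<omega> = mat 1"
  and mprod_Cons [simp]: "mprod (W # Ws) \<omega> = W \<omega> ** mprod Ws \<omega>"
  by (simp_all add: mprod_def)

lemma mprod_append: "mprod (Us @ Vs) \<omega> = mprod Us \<omega> ** mprod Vs \<omega>"
  by (induction Us) (simp_all add: matrix_mul_assoc)

lemma mprod_rev_fadj: "mprod (rev (map fadj Ws)) \<omega> = adj (mprod Ws \<omega>)"
  by (induction Ws) (simp_all add: mprod_append adj_mult fadj_def)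

lemma mprod_map_scaleR:
  "mprod (map (\<lambda>W \<omega>. c W *\<^sub>R W \<omega>) Ws) \<omega> = prod_list (map c Ws) *\<^sub>R mprod Ws \<omega>"
  by (induction Ws) (simp_all add: matrix_mult_scaleR_left matrix_mult_scaleR_right)

lemma mprod_map_comp: "mprod (map (\<lambda>W \<omega>. W (f \<omega>)) Ws) \<omega> = mprod Ws (f \<omega>)"
  by (induction Ws) simp_all

section \<open>Schatten moments of random matrices\<close>

text \<open>An alternating word of even length is the reflection of its second half, so its product
  is positive semidefinite. This is the source of the nonnegativity of the moments.\<close>

lemma mprod_alternating_double:
  fixes W :: "'b \<Rightarrow> complex ^ 'n ^ 'n" and p :: nat
  defines "V \<equiv> (if even p then W else fadj W)"
  shows "mprod (alternating fadj (2 * p) W) \<omega> =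
    adj (mprod (alternating fadj p V) \<omega>) ** mprod (alternating fadj p V) \<omega>"
proof -
  have "alternating fadj (2 * p) W = rev (map fadj (alternating fadj p V)) @ alternating fadj p V"
    using alternating_reflect[of fadj V p] by (cases "even p") (simp_all add: V_def)
  then show ?thesis by (simp add: mprod_append mprod_rev_fadj)
qed

lemma borel_measurable_matrix_mult [measurable (raw)]:
  fixes U V :: "'b \<Rightarrow> complex ^ 'n ^ 'n"
  assumes "U \<in> borel_measurable N" "V \<in> borel_measurable N"
  shows "(\<lambda>\<omega>. U \<omega> ** V \<omega>) \<in> borel_measurable N"
proof (rule borel_measurable_continuous_Pair[OF assms])
  show "continuous_on UNIV (\<lambda>x::(complex ^ 'n ^ 'n) \<times> (complex ^ 'n ^ 'n). fst x ** snd x)"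
    by (intro bounded_bilinear.continuous_on[OF bounded_bilinear_matrix_mult] continuous_intros)
qed

section \<open>Almost surely bounded random matrices\<close>

context prob_space
begin

text \<open>This class is closed under sums, products and adjoints and consists of integrable
  functions, so integrability of any word reduces to membership of its letters.\<close>

definition bounded_rv :: "('a \<Rightarrow> complex ^ 'n ^ 'n) set" where
  "bounded_rv = {W \<in> borel_measurable M. \<exists>C. AE \<omega> in M. norm (W \<omega>) \<le> C}"

lemma bounded_rvI: "W \<in> borel_measurable M \<Longrightarrow> AE \<omega> in M. norm (W \<omega>) \<le> C \<Longrightarrow> W \<in> bounded_rv"
  by (auto simp: bounded_rv_def)

lemma bounded_rv_measurable: "W \<in> bounded_rv \<Longrightarrow> W \<in> borel_measurable M"
  by (simp add: bounded_rv_def)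

lemma integrable_bounded_rv: "W \<in> bounded_rv \<Longrightarrow> integrable M W"
  by (auto simp: bounded_rv_def intro: integrable_const_bound)

lemma bounded_rv_const [simp, intro]: "(\<lambda>_. A) \<in> bounded_rv"
  by (rule bounded_rvI[where C = "norm A"]) auto

lemma bounded_rv_bounded_linear:
  assumes "bounded_linear f" "W \<in> bounded_rv"
  shows "(\<lambda>\<omega>. f (W \<omega>)) \<in> bounded_rv"
proof -
  obtain C where C: "AE \<omega> in M. norm (W \<omega>) \<le> C" and W: "W \<in> borel_measurable M"
    using assms(2) by (auto simp: bounded_rv_def)
  obtain K where K: "0 \<le> K" "\<And>x. norm (f x) \<le> norm x * K"
    using bounded_linear.nonneg_bounded[OF assms(1)] by blast
  show ?thesis
  proof (rule bounded_rvI[where C = "C * K"])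
    show "(\<lambda>\<omega>. f (W \<omega>)) \<in> borel_measurable M"
      by (rule borel_measurable_continuous_on[OF _ W])
         (rule linear_continuous_on[OF assms(1)])
    show "AE \<omega> in M. norm (f (W \<omega>)) \<le> C * K"
      using C by eventually_elim (meson K mult_right_mono order_trans)
  qed
qed

lemma bounded_rv_fadj [intro]: "W \<in> bounded_rv \<Longrightarrow> fadj W \<in> bounded_rv"
  using bounded_rv_bounded_linear[OF bounded_linear_adj] by (simp add: fadj_def[abs_def])

lemma bounded_rv_scaleR [intro]: "W \<in> bounded_rv \<Longrightarrow> (\<lambda>\<omega>. r *\<^sub>R W \<omega>) \<in> bounded_rv"
  using bounded_rv_bounded_linear[OF bounded_linear_scaleR_right] .

lemma bounded_rv_add [intro]:
  assumes "U \<in> bounded_rv" "V \<in> bounded_rv" shows "(\<lambda>\<omega>. U \<omega> + V \<omega>) \<in> bounded_rv"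
proof -
  obtain C D where "AE \<omega> in M. norm (U \<omega>) \<le> C" "AE \<omega> in M. norm (V \<omega>) \<le> D"
    using assms by (auto simp: bounded_rv_def)
  then have "AE \<omega> in M. norm (U \<omega> + V \<omega>) \<le> C + D"
    by eventually_elim (meson add_mono norm_triangle_ineq order_trans)
  then show ?thesis
    using assms[THEN bounded_rv_measurable] by (intro bounded_rvI) auto
qed

lemma bounded_rv_diff [intro]:
  assumes "U \<in> bounded_rv" "V \<in> bounded_rv" shows "(\<lambda>\<omega>. U \<omega> - V \<omega>) \<in> bounded_rv"
  using bounded_rv_add[OF assms(1) bounded_rv_scaleR[OF assms(2), of "-1"]] by simp

lemma bounded_rv_mult [intro]:
  fixes U V :: "'a \<Rightarrow> complex ^ 'n ^ 'n"
  assumes "U \<in> bounded_rv" "V \<in> bounded_rv" shows "(\<lambda>\<omega>. U \<omega> ** V \<omega>) \<in> bounded_rv"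
proof -
  obtain C D where CD: "AE \<omega> in M. norm (U \<omega>) \<le> C" "AE \<omega> in M. norm (V \<omega>) \<le> D"
    using assms by (auto simp: bounded_rv_def)
  obtain K where K: "0 \<le> K" "\<And>(A :: complex ^ 'n ^ 'n) (B :: complex ^ 'n ^ 'n). norm (A ** B) \<le> norm A * norm B * K"
    using bounded_bilinear.nonneg_bounded[OF bounded_bilinear_matrix_mult] by blast
  have "AE \<omega> in M. norm (U \<omega> ** V \<omega>) \<le> C * D * K"
    using CD
  proof eventually_elim
    case (elim \<omega>)
    have "norm (U \<omega> ** V \<omega>) \<le> norm (U \<omega>) * norm (V \<omega>) * K"
      by (rule K(2))
    also have "\<dots> \<le> C * D * K"
      using elim order_trans[OF norm_ge_zero elim(1)] K(1) by (intro mult_right_mono mult_mono) auto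
    finally show ?case .
  qed
  then show ?thesis
    using assms[THEN bounded_rv_measurable] by (intro bounded_rvI) auto
qed

lemma bounded_rv_mprod: "set Ws \<subseteq> bounded_rv \<Longrightarrow> mprod Ws \<in> bounded_rv"
proof (induction Ws)
  case Nil
  then show ?case using bounded_rv_const[of "mat 1"] by (simp add: mprod_def[abs_def])
next
  case (Cons W Ws)
  then have "(\<lambda>\<omega>. W \<omega> ** mprod Ws \<omega>) \<in> bounded_rv" by (intro bounded_rv_mult) auto
  then show ?case by (simp add: mprod_def[abs_def])
qed

lemma bounded_rv_alternating: "W \<in> bounded_rv \<Longrightarrow> set (alternating fadj n W) \<subseteq> bounded_rv"
  using set_alternating_subset[of fadj n W] by auto

definition expected_trace :: "('a \<Rightarrow> complex ^ 'n ^ 'n) \<Rightarrow> real" where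
  "expected_trace W = expectation (\<lambda>\<omega>. re_trace (W \<omega>))"

lemma integrable_re_trace: "W \<in> bounded_rv \<Longrightarrow> integrable M (\<lambda>\<omega>. re_trace (W \<omega>))"
  by (rule integrable_bounded_linear[OF bounded_linear_re_trace integrable_bounded_rv])

lemma expected_trace_add:
  "U \<in> bounded_rv \<Longrightarrow> V \<in> bounded_rv \<Longrightarrow>
     expected_trace (\<lambda>\<omega>. U \<omega> + V \<omega>) = expected_trace U + expected_trace V"
  by (simp add: expected_trace_def bounded_linear.linear[OF bounded_linear_re_trace] linear_add
      integrable_re_trace)

lemma expected_trace_scaleR: "expected_trace (\<lambda>\<omega>. r *\<^sub>R W \<omega>) = r * expected_trace W"
  by (simp add: expected_trace_def bounded_linear.linear[OF bounded_linear_re_trace] linear_scale)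

lemma expected_trace_append_commute:
  "expected_trace (mprod (Us @ Vs)) = expected_trace (mprod (Vs @ Us))"
  by (simp add: expected_trace_def mprod_append re_trace_mult_commute[of "mprod Us _"])

text \<open>Pointwise, the trace of a product is an inner product, at most half the sum of the two
  squared norms by Cauchy-Schwarz; each squared norm is the trace of a reflected word. This is the
  reflection hypothesis of \<open>chessboard_le_one\<close>.\<close>

lemma expected_trace_append_le:
  fixes Us Vs :: "('a \<Rightarrow> complex ^ 'n ^ 'n) list"
  assumes "set Us \<subseteq> bounded_rv" "set Vs \<subseteq> bounded_rv"
  shows "expected_trace (mprod (Us @ Vs)) \<le>
    (expected_trace (mprod (rev (map fadj Us) @ Us)) + expected_trace (mprod (Vs @ rev (map fadj Vs)))) / 2"
proof -
  have rf: "set (rev (map fadj Ws)) \<subseteq> bounded_rv" if "set Ws \<subseteq> bounded_rv" for Ws :: "('a \<Rightarrow> complex ^ 'n ^ 'n) list"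
    using that by auto
  have int: "integrable M (\<lambda>\<omega>. re_trace (mprod Ws \<omega>))" if "set Ws \<subseteq> bounded_rv" for Ws :: "('a \<Rightarrow> complex ^ 'n ^ 'n) list"
    using that by (intro integrable_re_trace bounded_rv_mprod)
  have le: "re_trace (mprod (Us @ Vs) \<omega>) \<le>
     (re_trace (mprod (rev (map fadj Us) @ Us) \<omega>) + re_trace (mprod (Vs @ rev (map fadj Vs)) \<omega>)) / 2" for \<omega>
  proof -
    have "re_trace (mprod (Us @ Vs) \<omega>) = adj (mprod Us \<omega>) \<bullet> mprod Vs \<omega>"
      using re_trace_adj_mult[of "adj (mprod Us \<omega>)"] by (simp add: mprod_append)
    also have "\<dots> \<le> norm (mprod Us \<omega>) * norm (mprod Vs \<omega>)"
      using norm_cauchy_schwarz[of "adj (mprod Us \<omega>)"] by simp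
    also have "\<dots> \<le> ((norm (mprod Us \<omega>))\<^sup>2 + (norm (mprod Vs \<omega>))\<^sup>2) / 2"
      using sum_squares_bound[of "norm (mprod Us \<omega>)" "norm (mprod Vs \<omega>)"] by simp
    also have "(norm (mprod Us \<omega>))\<^sup>2 = re_trace (mprod (rev (map fadj Us) @ Us) \<omega>)"
      by (simp add: mprod_append mprod_rev_fadj re_trace_adj_mult power2_norm_eq_inner)
    also have "(norm (mprod Vs \<omega>))\<^sup>2 = re_trace (mprod (Vs @ rev (map fadj Vs)) \<omega>)"
      by (simp add: mprod_append mprod_rev_fadj re_trace_mult_commute[of "mprod Vs \<omega>"]
          re_trace_adj_mult power2_norm_eq_inner)
    finally show ?thesis .
  qed
  have ints: "integrable M (\<lambda>\<omega>. re_trace (mprod (Us @ Vs) \<omega>))"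
    "integrable M (\<lambda>\<omega>. re_trace (mprod (rev (map fadj Us) @ Us) \<omega>))"
    "integrable M (\<lambda>\<omega>. re_trace (mprod (Vs @ rev (map fadj Vs)) \<omega>))"
    using assms rf[OF assms(1)] rf[OF assms(2)]
    by (auto simp only: set_append Un_least intro!: int)
  have "expected_trace (mprod (Us @ Vs)) \<le> expectation (\<lambda>\<omega>.
     (re_trace (mprod (rev (map fadj Us) @ Us) \<omega>) + re_trace (mprod (Vs @ rev (map fadj Vs)) \<omega>)) / 2)"
    unfolding expected_trace_def
    by (intro integral_mono le integrable_divide Bochner_Integration.integrable_add ints)
  also have "\<dots> = (expected_trace (mprod (rev (map fadj Us) @ Us)) + expected_trace (mprod (Vs @ rev (map fadj Vs)))) / 2"
    unfolding expected_trace_def using ints by simp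
  finally show ?thesis .
qed

section \<open>Schatten moments and the Hoelder inequality for words\<close>

definition moment :: "nat \<Rightarrow> ('a \<Rightarrow> complex ^ 'n ^ 'n) \<Rightarrow> real" where
  "moment p W = expected_trace (mprod (alternating fadj (2 * p) W))"

definition schatten :: "nat \<Rightarrow> ('a \<Rightarrow> complex ^ 'n ^ 'n) \<Rightarrow> real" where
  "schatten p W = root (2 * p) (moment p W)"

lemma moment_nonneg: "0 \<le> moment p W"
  unfolding moment_def expected_trace_def mprod_alternating_double re_trace_adj_mult
  by (intro integral_nonneg_AE) simp

lemma schatten_nonneg: "0 \<le> schatten p W"
  unfolding schatten_def by (rule real_root_ge_zero[OF moment_nonneg])

lemma schatten_power: "0 < p \<Longrightarrow> schatten p W ^ (2 * p) = moment p W"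
  by (simp add: schatten_def moment_nonneg)

text \<open>Moving the first letter \<open>W\<close> of the alternating word to its end gives the
  alternating word that begins with \<open>fadj W\<close>, and the trace is cyclic.\<close>

lemma moment_fadj: "moment p (fadj W) = moment p W"
proof (cases p)
  case (Suc k)
  have "alternating fadj (Suc (2 * k + 1)) (fadj W) = alternating fadj (2 * k + 1) (fadj W) @ [W]"
    by (simp add: alternating_def)
  moreover have "alternating fadj (Suc (2 * k + 1)) W = [W] @ alternating fadj (2 * k + 1) (fadj W)"
    using alternating_Suc[of fadj W] by simp
  moreover have "2 * p = Suc (2 * k + 1)" using Suc by simp
  ultimately show ?thesis
    unfolding moment_def by (simp only: expected_trace_append_commute[of "[W]"])
qed (simp add: moment_def alternating_def)

lemma schatten_fadj: "schatten p (fadj W) = schatten p W"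
  by (simp add: schatten_def moment_fadj)

lemma moment_scaleR: "moment p (\<lambda>\<omega>. r *\<^sub>R W \<omega>) = r ^ (2 * p) * moment p W"
proof -
  have "alternating fadj (2 * p) (\<lambda>\<omega>. r *\<^sub>R W \<omega>) =
      map (\<lambda>V \<omega>. r *\<^sub>R V \<omega>) (alternating fadj (2 * p) W)"
    by (simp add: alternating_def fadj_def[abs_def] adj_scaleR)
  then have "moment p (\<lambda>\<omega>. r *\<^sub>R W \<omega>) =
      expected_trace (\<lambda>\<omega>. prod_list (map (\<lambda>_. r) (alternating fadj (2 * p) W)) *\<^sub>R
        mprod (alternating fadj (2 * p) W) \<omega>)"
    by (simp only: moment_def expected_trace_def mprod_map_scaleR)
  then show ?thesis
    by (simp only: expected_trace_scaleR moment_def map_replicate_const length_alternating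
        prod_list_replicate)
qed

lemma schatten_scaleR:
  assumes "0 < p"
  shows "schatten p (\<lambda>\<omega>. r *\<^sub>R W \<omega>) = \<bar>r\<bar> * schatten p W"
proof -
  have "root (2 * p) (r ^ (2 * p)) = root (2 * p) (\<bar>r\<bar> ^ (2 * p))"
    by (subst power_even_abs) simp_all
  also have "\<dots> = \<bar>r\<bar>"
    using assms by (intro real_root_power_cancel) auto
  finally show ?thesis
    by (simp add: schatten_def moment_scaleR real_root_mult)
qed

text \<open>Once each letter is normalised, alternating words have expected trace at most 1, and the
  chessboard estimate extends this to all words of that length. Homogeneity restores the
  norms.\<close>

lemma schatten_hoelder:
  fixes Ws :: "('a \<Rightarrow> complex ^ 'n ^ 'n) list"
  assumes p: "0 < p" and Ws: "set Ws \<subseteq> bounded_rv" "length Ws = 2 * p"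
  shows "expected_trace (mprod Ws) \<le> prod_list (map (schatten p) Ws)"
proof -
  have eps: "expected_trace (mprod Ws) \<le> prod_list (map (\<lambda>W. schatten p W + e) Ws)" if e: "0 < e" for e
  proof -
    \<comment> \<open>The shift by \<open>e\<close> allows letters of norm zero; it is removed at
      the end by letting \<open>e\<close> tend to 0 from the right.\<close>
    define c where "c W = 1 / (schatten p W + e)" for W :: "'a \<Rightarrow> complex ^ 'n ^ 'n"
    define g where "g W = (\<lambda>\<omega>. c W *\<^sub>R W \<omega>)" for W
    have spos: "0 < schatten p W + e" for W :: "'a \<Rightarrow> complex ^ 'n ^ 'n"
      using schatten_nonneg[of p W] e by simp
    have cpos: "0 < c W" for W using spos by (simp add: c_def)
    have gadj: "fadj (g W) = g (fadj W)" for W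
      by (simp add: g_def c_def schatten_fadj fadj_def[abs_def] adj_scaleR)
        (simp add: schatten_fadj[unfolded fadj_def[abs_def]])
    \<comment> \<open>Reflection introduces adjoints, so the alphabet must contain them; by
      \<open>gadj\<close> they are normalised by the same constants.\<close>
    define L where "L = g ` (set Ws \<union> fadj ` set Ws)"
    have L: "L \<subseteq> bounded_rv" using Ws(1) by (auto simp: L_def g_def)
    have "expected_trace (mprod (map g Ws)) \<le> 1"
    proof (rule chessboard_le_one[where L = L and st = fadj and p = p])
      show "finite L" by (simp add: L_def)
      show "fadj a \<in> L" if "a \<in> L" for a using that by (auto simp: L_def gadj)
      show "expected_trace (mprod (alternating fadj (2 * p) a)) \<le> 1" if aL: "a \<in> L" for a
      proof -
        obtain W where a: "a = g W" using aL unfolding L_def by blast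
        have "\<bar>c W\<bar> * schatten p W \<le> 1"
          using cpos[of W] schatten_nonneg[of p W] e by (simp add: c_def)
        then have "schatten p a \<le> 1"
          unfolding a g_def schatten_scaleR[OF p] .
        then have "schatten p a ^ (2 * p) \<le> 1"
          by (rule power_le_one[OF schatten_nonneg])
        then show ?thesis by (simp add: schatten_power[OF p]) (simp add: moment_def)
      qed
      show "set (map g Ws) \<subseteq> L" by (auto simp: L_def)
      show "expected_trace (mprod (u @ v)) \<le>
        (expected_trace (mprod (rev (map fadj u) @ u)) + expected_trace (mprod (v @ rev (map fadj v)))) / 2"
        if "set u \<subseteq> L" "set v \<subseteq> L" for u v
        using that L by (intro expected_trace_append_le) auto
    qed (use p Ws in \<open>simp_all add: expected_trace_append_commute\<close>)
    moreover have "expected_trace (mprod (map g Ws)) = prod_list (map c Ws) * expected_trace (mprod Ws)"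
      unfolding g_def expected_trace_scaleR[symmetric] by (simp add: expected_trace_def mprod_map_scaleR)
    moreover have unit: "prod_list (map c Ws) * prod_list (map (\<lambda>W. schatten p W + e) Ws) = 1"
      by (induction Ws) (use spos in \<open>auto simp: c_def order_less_imp_not_eq2\<close>)
    moreover have "0 \<le> prod_list (map (\<lambda>W. schatten p W + e) Ws)"
      by (induction Ws) (use spos in \<open>auto intro!: mult_nonneg_nonneg dest: less_imp_le simp del: mult_nonneg_nonneg\<close>)
    ultimately have "prod_list (map (\<lambda>W. schatten p W + e) Ws) * (prod_list (map c Ws) * expected_trace (mprod Ws))
        \<le> prod_list (map (\<lambda>W. schatten p W + e) Ws) * 1"
      by (intro mult_left_mono) simp_all
    then show ?thesis
      by (simp only: mult.assoc[symmetric] mult.commute[of _ "prod_list (map c Ws)"] unit mult_1_left mult_1_right)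
  qed
  have lim: "((\<lambda>e. prod_list (map (\<lambda>W. schatten p W + e) Vs)) \<longlongrightarrow> prod_list (map (\<lambda>W. schatten p W + 0) Vs)) (at_right 0)" for Vs :: "('a \<Rightarrow> complex ^ 'n ^ 'n) list"
  proof (induction Vs)
    case (Cons V Vs)
    then show ?case by (simp only: list.map prod_list.Cons) (intro tendsto_intros)
  qed simp
  show ?thesis
    using tendsto_lowerbound[OF lim[of Ws], of "expected_trace (mprod Ws)"] eps
    by (simp add: eventually_at_right_less eventually_mono[OF eventually_at_right_less])
qed

end

section \<open>Uniform smoothness\<close>

lemma binomial_Suc_real: "real (Suc k) * real (n choose Suc k) = (real n - real k) * real (n choose k)"
proof (cases "k \<le> n")
  case True
  have "Suc k * (n choose Suc k) = (n - k) * (n choose k)"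
    using binomial_absorption[of k "n"] binomial_absorb_comp[of n k] by simp
  then have "real (Suc k * (n choose Suc k)) = real ((n - k) * (n choose k))" by simp
  with True show ?thesis by (simp add: of_nat_diff algebra_simps)
qed (simp add: binomial_eq_0)

text \<open>Compare ratios of consecutive terms in \<open>j\<close>: the common factor is
  \<open>(p - j) / (j + 1)\<close>, and what remains is
  \<open>2 * p - (2 * j + 1) \<le> (2 * p - 1) * (2 * j + 1)\<close>.\<close>

lemma binomial_double_le:
  assumes "0 < p" "j \<le> p"
  shows "real (2 * p choose (2 * j)) \<le> real (p choose j) * (2 * real p - 1) ^ j"
  using assms(2)
proof (induction j)
  case (Suc j)
  define a b where "a = real j" and "b = real p"
  have ab: "0 \<le> a" "a + 1 \<le> b" using Suc.prems by (simp_all add: a_def b_def)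
  have e1: "(2 * a + 2) * real (2 * p choose (2 * Suc j)) = (2 * b - (2 * a + 1)) * real (2 * p choose Suc (2 * j))"
    using binomial_Suc_real[of "Suc (2 * j)" "2 * p"] by (simp add: a_def b_def algebra_simps)
  have e2: "(2 * a + 1) * real (2 * p choose Suc (2 * j)) = (2 * b - 2 * a) * real (2 * p choose (2 * j))"
    using binomial_Suc_real[of "2 * j" "2 * p"] by (simp add: a_def b_def algebra_simps)
  have e3: "(a + 1) * real (p choose Suc j) = (b - a) * real (p choose j)"
    using binomial_Suc_real[of j p] by (simp add: a_def b_def algebra_simps)
  have "(2 * a + 1) * (a + 1) * real (2 * p choose (2 * Suc j))
      = (2 * b - (2 * a + 1)) * (b - a) * real (2 * p choose (2 * j))"
    using arg_cong[OF e1, of "\<lambda>z. (2 * a + 1) * z / 2"] arg_cong[OF e2, of "\<lambda>z. (2 * b - (2 * a + 1)) * z / 2"]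
    by (simp add: field_simps)
  also have "\<dots> \<le> ((2 * b - 1) * (2 * a + 1)) * (b - a) * (real (p choose j) * (2 * b - 1) ^ j)"
  proof (intro mult_mono)
    have "0 \<le> a * (2 * b)" using ab by simp
    then show "2 * b - (2 * a + 1) \<le> (2 * b - 1) * (2 * a + 1)"
      by (simp add: algebra_simps)
    show "real (2 * p choose (2 * j)) \<le> real (p choose j) * (2 * b - 1) ^ j"
      using Suc by (simp add: b_def)
  qed (use ab in auto)
  also have "\<dots> = (2 * a + 1) * ((b - a) * real (p choose j)) * (2 * b - 1) ^ Suc j"
    by simp
  also have "\<dots> = (2 * a + 1) * (a + 1) * (real (p choose Suc j) * (2 * b - 1) ^ Suc j)"
    unfolding e3[symmetric] by (simp only: mult.assoc)
  finally have "(2 * a + 1) * (a + 1) * real (2 * p choose (2 * Suc j))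
     \<le> (2 * a + 1) * (a + 1) * (real (p choose Suc j) * (2 * b - 1) ^ Suc j)" .
  moreover have "0 < (2 * a + 1) * (a + 1)" using ab by simp
  ultimately show ?case by (simp only: mult_le_cancel_left_pos b_def)
qed simp

text \<open>Odd powers of \<open>y\<close> cancel in the sum on the left. The even ones are compared
  with the binomial expansion on the right, coefficient by coefficient.\<close>

lemma two_point_scalar:
  fixes x y :: real
  assumes "0 < p"
  shows "(x + y) ^ (2 * p) + (x - y) ^ (2 * p) \<le> 2 * (x\<^sup>2 + (2 * real p - 1) * y\<^sup>2) ^ p"
proof -
  let ?f = "\<lambda>k. real (2 * p choose k) * y ^ k * x ^ (2 * p - k)"
  have "(x + y) ^ (2 * p) + (x - y) ^ (2 * p) =
      (\<Sum>k\<le>2 * p. ?f k) + (\<Sum>k\<le>2 * p. real (2 * p choose k) * (- y) ^ k * x ^ (2 * p - k))"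
    using binomial_ring[of y x "2 * p"] binomial_ring[of "- y" x "2 * p"] by (simp add: add.commute)
  also have "\<dots> = (\<Sum>k\<le>2 * p. if even k then 2 * ?f k else 0)"
    unfolding sum.distrib[symmetric] by (intro sum.cong) auto
  also have "\<dots> = (\<Sum>k\<in>(*) 2 ` {..p}. 2 * ?f k)"
    by (rule sum.mono_neutral_cong_right) (auto elim!: evenE simp: image_iff)
  also have "\<dots> = (\<Sum>j\<le>p. 2 * ?f (2 * j))"
    by (subst sum.reindex) (auto simp: inj_on_def)
  also have "\<dots> \<le> (\<Sum>j\<le>p. 2 * (real (p choose j) * ((2 * real p - 1) * y\<^sup>2) ^ j * (x\<^sup>2) ^ (p - j)))"
  proof (rule sum_mono)
    fix j assume j: "j \<in> {..p}"
    then have "2 * p - 2 * j = 2 * (p - j)" by simp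
    then have "?f (2 * j) = real (2 * p choose (2 * j)) * ((y\<^sup>2) ^ j * (x\<^sup>2) ^ (p - j))"
      by (simp add: power_mult)
    also have "\<dots> \<le> (real (p choose j) * (2 * real p - 1) ^ j) * ((y\<^sup>2) ^ j * (x\<^sup>2) ^ (p - j))"
      using binomial_double_le[OF assms, of j] j by (intro mult_right_mono) auto
    finally show "2 * ?f (2 * j) \<le> 2 * (real (p choose j) * ((2 * real p - 1) * y\<^sup>2) ^ j * (x\<^sup>2) ^ (p - j))"
      by (simp add: power_mult_distrib mult_ac)
  qed
  also have "\<dots> = 2 * (x\<^sup>2 + (2 * real p - 1) * y\<^sup>2) ^ p"
    using binomial_ring[of "(2 * real p - 1) * y\<^sup>2" "x\<^sup>2" p]
    by (simp add: sum_distrib_left[symmetric] add.commute)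
  finally show ?thesis .
qed

text \<open>The induction step is Chebyshev's inequality: \<open>a ^ p - b ^ p\<close> and
  \<open>a - b\<close> have the same sign.\<close>

lemma power_mean_le:
  fixes a b :: real
  assumes "0 \<le> a" "0 \<le> b"
  shows "((a + b) / 2) ^ p \<le> (a ^ p + b ^ p) / 2"
proof (induction p)
  case (Suc p)
  have "0 \<le> (a ^ p - b ^ p) * (a - b)"
  proof (cases "a \<le> b")
    case True
    then show ?thesis using assms by (intro mult_nonpos_nonpos) (auto intro: power_mono)
  next
    case False
    then show ?thesis using assms by (intro mult_nonneg_nonneg) (auto intro: power_mono)
  qed
  then have "(a ^ p + b ^ p) * (a + b) \<le> 2 * (a ^ Suc p + b ^ Suc p)"
    by (simp add: algebra_simps)
  moreover have "((a + b) / 2) ^ Suc p \<le> (a ^ p + b ^ p) / 2 * ((a + b) / 2)"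
    using mult_left_mono[OF Suc, of "(a + b) / 2"] assms by (simp add: mult.commute)
  ultimately show ?case by simp
qed simp

text \<open>The hypothesis \<open>mid\<close> is midpoint concavity of
  \<open>f t - C * t\<^sup>2\<close>. Summing second differences over a grid of mesh
  \<open>1 / (m + 1)\<close> avoids derivatives and continuity.\<close>

lemma le_add_of_midpoint:
  fixes f :: "real \<Rightarrow> real"
  assumes mid: "\<And>t h. f (t + h) + f (t - h) \<le> 2 * f t + 2 * C * h\<^sup>2"
    and min: "\<And>t. f 0 \<le> f t"
  shows "f 1 \<le> f 0 + C"
proof (rule LIMSEQ_le_const)
  have "(\<lambda>m. f 0 + C + C * (1 / real (Suc m))) \<longlonglongrightarrow> f 0 + C + C * 0"
    by (intro tendsto_intros lim_1_over_n[THEN LIMSEQ_Suc])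
  then show "(\<lambda>m. f 0 + C + C * (1 / real (Suc m))) \<longlonglongrightarrow> f 0 + C" by simp
  have "f 1 \<le> f 0 + C + C * (1 / real (Suc m))" for m
  proof -
    define h where "h = 1 / real (Suc m)"
    \<comment> \<open>The minimum at 0 bounds the first increment by
      \<open>2 * C * h\<^sup>2\<close>; by \<open>mid\<close>, each later increment exceeds the
      previous one by at most the same amount.\<close>
    have step: "f (real (Suc k) * h) - f (real k * h) \<le> 2 * C * h\<^sup>2 * real (Suc k)" for k
    proof (induction k)
      case 0
      show ?case using mid[of 0 h] min[of "- h"] by simp
    next
      case (Suc k)
      then show ?case using mid[of "real (Suc k) * h" h] by (simp add: algebra_simps)
    qed
    have "f (real k * h) \<le> f 0 + C * h\<^sup>2 * (real k * real (Suc k))" for k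
    proof (induction k)
      case (Suc k)
      then show ?case using step[of k] by (simp add: algebra_simps)
    qed simp
    from this[of "Suc m"] have "f 1 \<le> f 0 + C * h\<^sup>2 * (real (Suc m) * real (Suc (Suc m)))"
      by (simp add: h_def)
    also have "h\<^sup>2 * (real (Suc m) * real (Suc (Suc m))) = 1 + 1 / real (Suc m)"
    proof -
      define N where "N = real (Suc m)"
      have "real (Suc (Suc m)) = N + 1" "0 < N" by (simp_all add: N_def)
      then show ?thesis by (simp add: h_def N_def[symmetric] field_simps power2_eq_square del: of_nat_Suc)
    qed
    then have "C * h\<^sup>2 * (real (Suc m) * real (Suc (Suc m))) = C + C * (1 / real (Suc m))"
      by (simp only: mult.assoc distrib_left mult_1_right)
    finally show ?thesis by simp
  qed
  then show "\<exists>N. \<forall>n\<ge>N. f 1 \<le> f 0 + C + C * (1 / real (Suc n))" by blast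
qed

section \<open>The two-point inequality and uniform smoothness for random matrices\<close>

context prob_space
begin

text \<open>Hoelder bounds words only from above, so the minus word cannot be estimated alone. In
  the sum weighted by \<open>e\<close>, every fully expanded word gets coefficient 0 or 2.
  \<open>Us\<close> holds the letters already chosen, and \<open>e\<close> records the parity still
  required of the remaining choices of \<open>Y\<close>.\<close>

lemma expected_trace_expand:
  fixes Us :: "('a \<Rightarrow> complex ^ 'n ^ 'n) list"
  assumes p: "0 < p" and e: "e = 1 \<or> e = - 1"
    and "set Us \<subseteq> bounded_rv" "fst ` set Ps \<subseteq> bounded_rv" "snd ` set Ps \<subseteq> bounded_rv"
    and "length Us + length Ps = 2 * p"
  shows "expected_trace (mprod (Us @ map (\<lambda>(X, Y) \<omega>. X \<omega> + Y \<omega>) Ps))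
      + e * expected_trace (mprod (Us @ map (\<lambda>(X, Y) \<omega>. X \<omega> - Y \<omega>) Ps))
    \<le> prod_list (map (schatten p) Us) * (prod_list (map (\<lambda>(X, Y). schatten p X + schatten p Y) Ps)
      + e * prod_list (map (\<lambda>(X, Y). schatten p X - schatten p Y) Ps))"
  using e assms(3-)
proof (induction Ps arbitrary: Us e)
  case Nil
  have "expected_trace (mprod Us) \<le> prod_list (map (schatten p) Us)"
    using schatten_hoelder[OF p] Nil by simp
  \<comment> \<open>Here \<open>1 + e\<close> is 0 or 2, so multiplying by it keeps the
    inequality.\<close>
  then have "expected_trace (mprod Us) * (1 + e) \<le> prod_list (map (schatten p) Us) * (1 + e)"
    using Nil(1) by (intro mult_right_mono) auto
  then show ?case by (simp add: algebra_simps)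
next
  case (Cons P Ps)
  obtain X Y where P: "P = (X, Y)" by (cases P)
  let ?plus = "map (\<lambda>(X, Y) \<omega>. X \<omega> + Y \<omega>) Ps" and ?minus = "map (\<lambda>(X, Y) \<omega>. X \<omega> - Y \<omega>) Ps"
  have b: "set Us \<subseteq> bounded_rv" "X \<in> bounded_rv" "Y \<in> bounded_rv"
    "set ?plus \<subseteq> bounded_rv" "set ?minus \<subseteq> bounded_rv"
  proof -
    have "a \<in> bounded_rv \<and> b \<in> bounded_rv" if "(a, b) \<in> set Ps" for a b
      using that Cons.prems(3,4) by force
    then show "set Us \<subseteq> bounded_rv" "X \<in> bounded_rv" "Y \<in> bounded_rv"
      "set ?plus \<subseteq> bounded_rv" "set ?minus \<subseteq> bounded_rv"
      using Cons.prems by (auto simp: P)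
  qed
  have split: "expected_trace (mprod (Us @ (\<lambda>\<omega>. X \<omega> + r *\<^sub>R Y \<omega>) # Vs)) =
      expected_trace (mprod ((Us @ [X]) @ Vs)) + r * expected_trace (mprod ((Us @ [Y]) @ Vs))"
    if "set Vs \<subseteq> bounded_rv" for r Vs
  proof -
    have "mprod (Us @ (\<lambda>\<omega>. X \<omega> + r *\<^sub>R Y \<omega>) # Vs) =
        (\<lambda>\<omega>. mprod ((Us @ [X]) @ Vs) \<omega> + r *\<^sub>R mprod ((Us @ [Y]) @ Vs) \<omega>)"
      by (simp add: fun_eq_iff mprod_append matrix_add_ldistrib matrix_mult_add_rdistrib
          matrix_mult_scaleR_left matrix_mult_scaleR_right)
    moreover have "mprod ((Us @ [X]) @ Vs) \<in> bounded_rv" "mprod ((Us @ [Y]) @ Vs) \<in> bounded_rv"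
      using b that by (auto intro!: bounded_rv_mprod)
    ultimately show ?thesis
      by (simp only: expected_trace_add expected_trace_scaleR bounded_rv_scaleR)
  qed
  have IH: "expected_trace (mprod ((Us @ [W]) @ ?plus)) + d * expected_trace (mprod ((Us @ [W]) @ ?minus))
    \<le> prod_list (map (schatten p) (Us @ [W])) *
      (prod_list (map (\<lambda>(X, Y). schatten p X + schatten p Y) Ps)
       + d * prod_list (map (\<lambda>(X, Y). schatten p X - schatten p Y) Ps))"
    if "d = 1 \<or> d = - 1" "W \<in> bounded_rv" for d W
    using that Cons.prems by (intro Cons.IH) auto
  \<comment> \<open>Choosing \<open>Y\<close> contributes a minus sign in the second word only,
    which flips \<open>e\<close>.\<close>
  have "- e = 1 \<or> - e = - 1" using Cons.prems(1) by auto
  note ih = IH[OF Cons.prems(1) b(2)] IH[OF this b(3)]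
  have "expected_trace (mprod (Us @ map (\<lambda>(X, Y) \<omega>. X \<omega> + Y \<omega>) (P # Ps))) =
      expected_trace (mprod ((Us @ [X]) @ ?plus)) + expected_trace (mprod ((Us @ [Y]) @ ?plus))"
    using split[OF b(4), of 1] by (simp add: P)
  moreover have "e * expected_trace (mprod (Us @ map (\<lambda>(X, Y) \<omega>. X \<omega> - Y \<omega>) (P # Ps))) =
      e * expected_trace (mprod ((Us @ [X]) @ ?minus)) + (- e) * expected_trace (mprod ((Us @ [Y]) @ ?minus))"
    using arg_cong[OF split[OF b(5), of "- 1"], of "(*) e"] by (simp add: P right_diff_distrib)
  moreover have "prod_list (map (schatten p) Us) *
       (prod_list (map (\<lambda>(X, Y). schatten p X + schatten p Y) (P # Ps))
         + e * prod_list (map (\<lambda>(X, Y). schatten p X - schatten p Y) (P # Ps))) =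
      prod_list (map (schatten p) (Us @ [X])) *
       (prod_list (map (\<lambda>(X, Y). schatten p X + schatten p Y) Ps)
         + e * prod_list (map (\<lambda>(X, Y). schatten p X - schatten p Y) Ps)) +
      prod_list (map (schatten p) (Us @ [Y])) *
       (prod_list (map (\<lambda>(X, Y). schatten p X + schatten p Y) Ps)
         + (- e) * prod_list (map (\<lambda>(X, Y). schatten p X - schatten p Y) Ps))"
    by (simp add: P algebra_simps)
  ultimately show ?case
    using ih by linarith
qed

lemma moment_two_point:
  fixes X Y :: "'a \<Rightarrow> complex ^ 'n ^ 'n"
  assumes p: "0 < p" and X: "X \<in> bounded_rv" and Y: "Y \<in> bounded_rv"
  shows "moment p (\<lambda>\<omega>. X \<omega> + Y \<omega>) + moment p (\<lambda>\<omega>. X \<omega> - Y \<omega>) \<le>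
    (schatten p X + schatten p Y) ^ (2 * p) + (schatten p X - schatten p Y) ^ (2 * p)"
proof -
  \<comment> \<open>Alternating the pair keeps \<open>X\<close> and \<open>Y\<close> starred at the
    same positions, matching the adjoints of \<open>X + Y\<close> and \<open>X - Y\<close>.\<close>
  define Ps where "Ps = alternating (map_prod fadj fadj) (2 * p) (X, Y)"
  have sub: "set Ps \<subseteq> {(X, Y), (fadj X, fadj Y)}"
    using set_alternating_subset[of "map_prod fadj fadj" "2 * p" "(X, Y)"] by (simp add: Ps_def)
  have len: "length Ps = 2 * p" by (simp add: Ps_def)
  have plus: "map (\<lambda>(X, Y) \<omega>. X \<omega> + Y \<omega>) Ps = alternating fadj (2 * p) (\<lambda>\<omega>. X \<omega> + Y \<omega>)"
    by (auto simp: Ps_def alternating_def fadj_def[abs_def] adj_add)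
  have minus: "map (\<lambda>(X, Y) \<omega>. X \<omega> - Y \<omega>) Ps = alternating fadj (2 * p) (\<lambda>\<omega>. X \<omega> - Y \<omega>)"
    by (auto simp: Ps_def alternating_def fadj_def[abs_def] linear_diff[OF bounded_linear.linear[OF bounded_linear_adj]])
  have c: "map (\<lambda>(X, Y). schatten p X + schatten p Y) Ps = map (\<lambda>_. schatten p X + schatten p Y) Ps"
    "map (\<lambda>(X, Y). schatten p X - schatten p Y) Ps = map (\<lambda>_. schatten p X - schatten p Y) Ps"
    using sub by (auto simp: schatten_fadj)
  have "fst ` set Ps \<subseteq> bounded_rv" "snd ` set Ps \<subseteq> bounded_rv"
    by (rule subset_trans[OF image_mono[OF sub]]; use X Y in auto)+
  from expected_trace_expand[OF p _ _ this, of 1 "[]"] show ?thesis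
    unfolding c by (simp add: len plus minus moment_def map_replicate_const)
qed

text \<open>The matrix and scalar two-point inequalities bound the sum of the \<open>p\<close>-th
  powers of the squared norms; the power mean inequality then removes the exponent
  \<open>p\<close>.\<close>

lemma schatten_two_point:
  fixes X Y :: "'a \<Rightarrow> complex ^ 'n ^ 'n"
  assumes p: "0 < p" and X: "X \<in> bounded_rv" and Y: "Y \<in> bounded_rv"
  shows "(schatten p (\<lambda>\<omega>. X \<omega> + Y \<omega>))\<^sup>2 + (schatten p (\<lambda>\<omega>. X \<omega> - Y \<omega>))\<^sup>2 \<le>
    2 * ((schatten p X)\<^sup>2 + (2 * real p - 1) * (schatten p Y)\<^sup>2)"
proof -
  define a b c where "a = (schatten p (\<lambda>\<omega>. X \<omega> + Y \<omega>))\<^sup>2" and "b = (schatten p (\<lambda>\<omega>. X \<omega> - Y \<omega>))\<^sup>2"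
    and "c = (schatten p X)\<^sup>2 + (2 * real p - 1) * (schatten p Y)\<^sup>2"
  have "a ^ p + b ^ p \<le> 2 * c ^ p"
    using order_trans[OF moment_two_point[OF assms] two_point_scalar[OF p]]
    by (simp add: a_def b_def c_def power_mult[symmetric] schatten_power[OF p])
  moreover have "((a + b) / 2) ^ p \<le> (a ^ p + b ^ p) / 2"
    by (rule power_mean_le) (simp_all add: a_def b_def)
  ultimately have "((a + b) / 2) ^ p \<le> c ^ p" by simp
  then have "(a + b) / 2 \<le> c"
    using p by (rule_tac power_le_imp_le_base[of _ "p - 1"]) (auto simp: c_def)
  then show ?thesis by (simp add: a_def b_def c_def)
qed

text \<open>The hypothesis \<open>orth\<close> says that the moment at \<open>X\<close> has
  vanishing first variation in the direction \<open>Y\<close>; it is the form in which a conditional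
  mean of zero enters.\<close>

lemma schatten_smooth:
  fixes X Y :: "'a \<Rightarrow> complex ^ 'n ^ 'n"
  assumes p: "0 < p" and X: "X \<in> bounded_rv" and Y: "Y \<in> bounded_rv"
    and orth: "expected_trace (mprod (Y # alternating fadj (2 * p - 1) (fadj X))) = 0"
  shows "(schatten p (\<lambda>\<omega>. X \<omega> + Y \<omega>))\<^sup>2 \<le> (schatten p X)\<^sup>2 + (2 * real p - 1) * (schatten p Y)\<^sup>2"
proof -
  define f where "f t = (schatten p (\<lambda>\<omega>. X \<omega> + t *\<^sub>R Y \<omega>))\<^sup>2" for t
  have XtY: "(\<lambda>\<omega>. X \<omega> + t *\<^sub>R Y \<omega>) \<in> bounded_rv" for t
    using X Y by auto
  have "f 1 \<le> f 0 + (2 * real p - 1) * (schatten p Y)\<^sup>2"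
  proof (rule le_add_of_midpoint)
    fix t h
    show "f (t + h) + f (t - h) \<le> 2 * f t + 2 * ((2 * real p - 1) * (schatten p Y)\<^sup>2) * h\<^sup>2"
      using schatten_two_point[OF p XtY[of t] bounded_rv_scaleR[OF Y, of h]]
      by (simp add: f_def schatten_scaleR[OF p] power_mult_distrib algebra_simps)
  next
    fix t
    \<comment> \<open>Minimality at 0: perturb only the first letter of the word for
      \<open>moment p X\<close>. By \<open>orth\<close> the expected trace stays the same, while
      Hoelder bounds it by \<open>?s\<close> times \<open>schatten p X\<close> to the power
      \<open>2 * p - 1\<close>, which cancels.\<close>
    let ?R = "alternating fadj (2 * p - 1) (fadj X)" and ?s = "schatten p (\<lambda>\<omega>. X \<omega> + t *\<^sub>R Y \<omega>)"
    have R: "set ?R \<subseteq> bounded_rv"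
      using X by (intro bounded_rv_alternating) auto
    have XR: "alternating fadj (2 * p) X = X # ?R"
      using alternating_Suc[of fadj X "2 * p - 1"] p by simp
    have b: "mprod (X # ?R) \<in> bounded_rv" "mprod (Y # ?R) \<in> bounded_rv"
      using X Y R by (auto intro!: bounded_rv_mprod)
    have "mprod ((\<lambda>\<omega>. X \<omega> + t *\<^sub>R Y \<omega>) # ?R) = (\<lambda>\<omega>. mprod (X # ?R) \<omega> + t *\<^sub>R mprod (Y # ?R) \<omega>)"
      by (simp add: fun_eq_iff matrix_mult_add_rdistrib matrix_mult_scaleR_left)
    then have "expected_trace (mprod ((\<lambda>\<omega>. X \<omega> + t *\<^sub>R Y \<omega>) # ?R)) = moment p X"
      using orth unfolding moment_def XR
      by (simp only: expected_trace_add[OF b(1) bounded_rv_scaleR[OF b(2)]] expected_trace_scaleR)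
    moreover have "expected_trace (mprod ((\<lambda>\<omega>. X \<omega> + t *\<^sub>R Y \<omega>) # ?R)) \<le>
        prod_list (map (schatten p) ((\<lambda>\<omega>. X \<omega> + t *\<^sub>R Y \<omega>) # ?R))"
      using p XtY R by (intro schatten_hoelder) auto
    moreover have "map (schatten p) ?R = replicate (2 * p - 1) (schatten p X)"
      by (rule nth_equalityI) (auto simp: nth_alternating schatten_fadj)
    ultimately have "schatten p X ^ (2 * p) \<le> ?s * schatten p X ^ (2 * p - 1)"
      by (simp add: schatten_power[OF p])
    moreover have "schatten p X ^ (2 * p) = schatten p X * schatten p X ^ (2 * p - 1)"
      using p power_Suc[of "schatten p X" "2 * p - 1"] by simp
    ultimately have "schatten p X \<le> ?s"
      using schatten_nonneg[of p X] schatten_nonneg[of p "\<lambda>\<omega>. X \<omega> + t *\<^sub>R Y \<omega>"]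
      by (cases "schatten p X = 0") (auto simp: mult_le_cancel_right)
    then show "f 0 \<le> f t"
      using schatten_nonneg[of p X] by (simp add: f_def)
  qed
  then show ?thesis by (simp add: f_def)
qed

text \<open>Write \<open>V\<close> for the product. Its moment is the expected squared Frobenius
  norm of \<open>V \<omega> ** adj (T \<omega>)\<close>, where
  \<open>adj (T \<omega>) ** T \<omega>\<close> is the product of the remaining
  \<open>2 * (p - 1)\<close> letters. There \<open>B\<close> comes out pointwise with factor
  \<open>C\<close>; Hoelder then gives a bound in which the remaining powers of
  \<open>schatten p V\<close> cancel.\<close>

lemma schatten_mult_le:
  fixes B W :: "'a \<Rightarrow> complex ^ 'n ^ 'n"
  assumes p: "0 < p" and B: "B \<in> bounded_rv" and W: "W \<in> bounded_rv"
    and C: "0 \<le> C" "AE \<omega> in M. spectral_norm (B \<omega>) \<le> C"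
  shows "schatten p (\<lambda>\<omega>. B \<omega> ** W \<omega>) \<le> C * schatten p W"
proof -
  define V where "V = (\<lambda>\<omega>. B \<omega> ** W \<omega>)"
  define R where "R = alternating fadj (2 * (p - 1)) (fadj V)"
  obtain T :: "'a \<Rightarrow> complex ^ 'n ^ 'n" where T: "\<And>\<omega>. mprod R \<omega> = adj (T \<omega>) ** T \<omega>"
    using that[of "mprod (alternating fadj (p - 1) (if even (p - 1) then fadj V else fadj (fadj V)))"]
    by (simp only: R_def mprod_alternating_double)
  have V: "V \<in> bounded_rv" using B W by (auto simp: V_def)
  then have R: "set R \<subseteq> bounded_rv" unfolding R_def by (intro bounded_rv_alternating) auto
  have tr: "re_trace (mprod (fadj U # U # R) \<omega>) = (norm (U \<omega> ** adj (T \<omega>)))\<^sup>2" for U \<omega>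
  proof -
    have "re_trace (mprod (fadj U # U # R) \<omega>) = re_trace ((adj (U \<omega>) ** U \<omega> ** adj (T \<omega>)) ** T \<omega>)"
      by (simp add: T fadj_def matrix_mul_assoc)
    also have "\<dots> = re_trace (T \<omega> ** (adj (U \<omega>) ** U \<omega> ** adj (T \<omega>)))"
      by (rule re_trace_mult_commute)
    also have "\<dots> = re_trace (adj (U \<omega> ** adj (T \<omega>)) ** (U \<omega> ** adj (T \<omega>)))"
      by (simp add: adj_mult matrix_mul_assoc)
    finally show ?thesis by (simp add: re_trace_adj_mult power2_norm_eq_inner)
  qed
  have split: "alternating fadj (2 * p) (fadj V) = fadj V # V # R"
  proof -
    have "2 * p = Suc (Suc (2 * (p - 1)))" using p by simp
    then show ?thesis by (simp add: R_def alternating_Suc del: mult_Suc_right)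
  qed
  have int: "integrable M (\<lambda>\<omega>. re_trace (mprod (fadj U # U # R) \<omega>))" if "U \<in> bounded_rv" for U
    using that R by (intro integrable_re_trace bounded_rv_mprod) auto
  have "schatten p V ^ (2 * p) = expected_trace (mprod (fadj V # V # R))"
    by (simp only: schatten_power[OF p] moment_fadj[of p V, symmetric] split[symmetric])
       (simp only: moment_def)
  also have "\<dots> \<le> expectation (\<lambda>\<omega>. C\<^sup>2 * re_trace (mprod (fadj W # W # R) \<omega>))"
    unfolding expected_trace_def
  proof (intro integral_mono_AE integrable_mult_right int V W)
    show "AE \<omega> in M. re_trace (mprod (fadj V # V # R) \<omega>) \<le> C\<^sup>2 * re_trace (mprod (fadj W # W # R) \<omega>)"
      using C(2)
    proof eventually_elim
      case (elim \<omega>)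
      have "norm (V \<omega> ** adj (T \<omega>)) \<le> spectral_norm (B \<omega>) * norm (W \<omega> ** adj (T \<omega>))"
        using norm_matrix_mult_le[of "B \<omega>" "W \<omega> ** adj (T \<omega>)"] by (simp add: V_def matrix_mul_assoc)
      also have "\<dots> \<le> C * norm (W \<omega> ** adj (T \<omega>))"
        using elim by (intro mult_right_mono) auto
      finally show ?case
        unfolding tr power_mult_distrib[symmetric] by (intro power_mono) auto
    qed
  qed
  also have "\<dots> = C\<^sup>2 * expected_trace (mprod (fadj W # W # R))"
    by (simp add: expected_trace_def)
  also have "\<dots> \<le> C\<^sup>2 * prod_list (map (schatten p) (fadj W # W # R))"
    using p W R by (intro mult_left_mono schatten_hoelder) (auto simp: R_def)
  also have "map (schatten p) R = replicate (2 * (p - 1)) (schatten p V)"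
    by (intro nth_equalityI) (auto simp: R_def nth_alternating schatten_fadj)
  then have "C\<^sup>2 * prod_list (map (schatten p) (fadj W # W # R)) =
      (C * schatten p W)\<^sup>2 * schatten p V ^ (2 * (p - 1))"
    by (simp add: schatten_fadj power2_eq_square)
  also have "schatten p V ^ (2 * p) = (schatten p V)\<^sup>2 * schatten p V ^ (2 * (p - 1))"
  proof -
    have "2 * p = 2 + 2 * (p - 1)" using p by simp
    then show ?thesis by (metis power_add)
  qed
  finally have "(schatten p V)\<^sup>2 * schatten p V ^ (2 * (p - 1)) \<le>
      (C * schatten p W)\<^sup>2 * schatten p V ^ (2 * (p - 1))" .
  then have "schatten p V \<le> C * schatten p W"
    using schatten_nonneg[of p V] schatten_nonneg[of p W] C(1)
    by (cases "schatten p V = 0") (auto simp: mult_le_cancel_right intro: power2_le_imp_le)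
  then show ?thesis by (simp add: V_def)
qed

end

section \<open>Spectral norm and independence\<close>

lemma norm_vec_power2: "(norm v)\<^sup>2 = (\<Sum>i\<in>UNIV. (norm (v $ i))\<^sup>2)"
  unfolding norm_vec_def L2_set_def by (rule real_sqrt_pow2) (simp add: sum_nonneg)

lemma norm_matrix_vector_le_frobenius:
  fixes A :: "complex ^ 'n ^ 'm"
  shows "norm (A *v x) \<le> norm A * norm x"
proof (rule power2_le_imp_le)
  have "norm ((A *v x) $ i) \<le> norm (A $ i) * norm x" for i
  proof -
    have "norm ((A *v x) $ i) \<le> (\<Sum>j\<in>UNIV. norm (A $ i $ j * x $ j))"
      unfolding matrix_vector_mult_def vec_lambda_beta by (rule norm_sum)
    also have "\<dots> = (\<Sum>j\<in>UNIV. \<bar>norm (A $ i $ j)\<bar> * \<bar>norm (x $ j)\<bar>)"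
      by (simp only: norm_mult abs_norm_cancel)
    also have "\<dots> \<le> norm (A $ i) * norm x"
      unfolding norm_vec_def by (rule L2_set_mult_ineq)
    finally show ?thesis .
  qed
  then have "(norm (A *v x))\<^sup>2 \<le> (\<Sum>i\<in>UNIV. (norm (A $ i) * norm x)\<^sup>2)"
    unfolding norm_vec_power2[of "A *v x"] by (intro sum_mono power_mono norm_ge_zero)
  also have "\<dots> = (norm A * norm x)\<^sup>2"
    unfolding norm_vec_power2[of A] power_mult_distrib sum_distrib_right ..
  finally show "(norm (A *v x))\<^sup>2 \<le> (norm A * norm x)\<^sup>2" .
qed simp

lemma inner_adj_matrix_vector: "(adj A *v y) \<bullet> z = y \<bullet> (A *v z)"
proof -
  have entry: "(cnj a * b) \<bullet> c = b \<bullet> (a * c)" for a b c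
    by (simp add: inner_complex_def algebra_simps)
  have "(adj A *v y) \<bullet> z = (\<Sum>j\<in>UNIV. \<Sum>i\<in>UNIV. (cnj (A $ i $ j) * y $ i) \<bullet> z $ j)"
    by (simp add: inner_vec_def matrix_vector_mult_def adj_def inner_sum_left)
  also have "\<dots> = (\<Sum>i\<in>UNIV. \<Sum>j\<in>UNIV. (cnj (A $ i $ j) * y $ i) \<bullet> z $ j)"
    by (rule sum.swap)
  also have "\<dots> = y \<bullet> (A *v z)"
    by (simp add: inner_vec_def matrix_vector_mult_def inner_sum_right entry)
  finally show ?thesis .
qed

text \<open>
  The norms of \<open>x\<close>, \<open>A x\<close>, \<open>A\<^sup>* A x\<close>, \<open>A A\<^sup>* A x\<close>, \<dots> form a log-convex sequence.
\<close>

lemma spectral_norm_power_le: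
  fixes W :: "'b \<Rightarrow> complex ^ 'n ^ 'n"
  assumes p: "0 < p"
  shows "spectral_norm (W \<omega>) ^ (2 * p) \<le> re_trace (mprod (alternating fadj (2 * p) (fadj W)) \<omega>)"
proof -
  \<comment> \<open>The letter depends on the parity of \<open>k\<close> so that the rightmost
    factor of \<open>T k\<close> is always \<open>W\<close> for \<open>k > 0\<close>, and
    \<open>T (Suc k)\<close> arises from \<open>T k\<close> by one more factor on the left.\<close>
  define V where "V k = (if even k then fadj W else W)" for k :: nat
  define T where "T k = mprod (alternating fadj k (V k)) \<omega>" for k
  have T_Suc: "T (Suc k) = V (Suc k) \<omega> ** T k" for k
  proof -
    have "fadj (V (Suc k)) = V k" by (simp add: V_def)
    then have "alternating fadj (Suc k) (V (Suc k)) = V (Suc k) # alternating fadj k (V k)"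
      using alternating_Suc[of fadj "V (Suc k)" k, OF fadj_fadj] by (simp only:)
    then show ?thesis by (simp only: T_def mprod_Cons)
  qed
  have T0: "T 0 = mat 1" by (simp add: T_def alternating_def)
  have adj_V: "adj (V (Suc k) \<omega>) = V k \<omega>" for k
    by (simp add: V_def fadj_def)
  have bound: "norm (W \<omega> *v x) \<le> root p (norm (T p)) * norm x" for x
  proof -
    define u where "u k = norm (T k *v x)" for k
    have logconvex: "(u (Suc k))\<^sup>2 \<le> u (Suc (Suc k)) * u k" for k
    proof -
      let ?y = "T (Suc k) *v x"
      have "(u (Suc k))\<^sup>2 = ?y \<bullet> (V (Suc k) \<omega> *v (T k *v x))"
        by (simp add: u_def power2_norm_eq_inner T_Suc matrix_vector_mul_assoc)
      also have "\<dots> = (V k \<omega> *v ?y) \<bullet> (T k *v x)"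
        by (simp add: inner_adj_matrix_vector[symmetric] adj_V)
      also have "V k \<omega> *v ?y = T (Suc (Suc k)) *v x"
        by (simp add: T_Suc[of "Suc k"] matrix_vector_mul_assoc V_def)
      finally show ?thesis
        using norm_cauchy_schwarz[of "T (Suc (Suc k)) *v x" "T k *v x"] by (simp add: u_def)
    qed
    have unn: "0 \<le> u k" for k by (simp add: u_def)
    \<comment> \<open>Log-convexity makes the ratios \<open>u (Suc k) / u k\<close> nondecreasing,
      so each is at least the first. The form without division also covers
      \<open>u k = 0\<close>.\<close>
    have ratio: "u 1 * u k \<le> u (Suc k) * u 0" for k
    proof (induction k)
      case (Suc k)
      show ?case
      proof (cases "u k = 0")
        case True
        with logconvex[of k] have "u (Suc k) = 0" by simp
        then show ?thesis using unn by simp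
      next
        case False
        have "u k * (u 1 * u (Suc k)) \<le> u (Suc k) * u 0 * u (Suc k)"
          using mult_right_mono[OF Suc unn[of "Suc k"]] by (simp add: mult_ac)
        also have "\<dots> \<le> u k * (u (Suc (Suc k)) * u 0)"
          using mult_right_mono[OF logconvex[of k] unn[of 0]] by (simp add: power2_eq_square mult_ac)
        finally show ?thesis using False unn[of k] by (simp add: mult_le_cancel_left)
      qed
    qed simp
    have "u 1 ^ Suc k \<le> u 0 ^ k * u (Suc k)" for k
    proof (induction k)
      case (Suc k)
      have "u 1 ^ Suc (Suc k) \<le> u 1 * (u 0 ^ k * u (Suc k))"
        using mult_left_mono[OF Suc unn[of 1]] by simp
      also have "\<dots> = u 0 ^ k * (u 1 * u (Suc k))" by simp
      also have "\<dots> \<le> u 0 ^ k * (u (Suc (Suc k)) * u 0)"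
        using unn by (intro mult_left_mono ratio) simp
      finally show ?case by (simp add: mult_ac)
    qed simp
    from this[of "p - 1"] have "u 1 ^ p \<le> u 0 ^ (p - 1) * u p" using p by simp
    also have "\<dots> \<le> u 0 ^ (p - 1) * (norm (T p) * u 0)"
      unfolding u_def using norm_matrix_vector_le_frobenius[of "T p" x]
      by (intro mult_left_mono) (simp_all add: T0)
    also have "\<dots> = norm (T p) * u 0 ^ p"
      using p by (cases p) simp_all
    also have "\<dots> = (root p (norm (T p)) * u 0) ^ p"
      using p by (simp add: power_mult_distrib)
    finally have "u 1 \<le> root p (norm (T p)) * u 0"
      using p unn[of 0] by (rule_tac power_le_imp_le_base[of _ "p - 1"]) simp_all
    then show ?thesis by (simp add: u_def T0 T_Suc) (simp add: V_def)
  qed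
  have "spectral_norm (W \<omega>) \<le> root p (norm (T p))"
    unfolding spectral_norm_def by (rule onorm_le[OF bound])
  then have "spectral_norm (W \<omega>) ^ (2 * p) \<le> root p (norm (T p)) ^ (2 * p)"
    by (intro power_mono spectral_norm_nonneg)
  also have "\<dots> = (norm (T p))\<^sup>2"
    using p by (simp add: mult.commute[of 2] power_mult)
  also have "\<dots> = re_trace (mprod (alternating fadj (2 * p) (fadj W)) \<omega>)"
    by (simp add: mprod_alternating_double re_trace_adj_mult power2_norm_eq_inner T_def V_def)
  finally show ?thesis .
qed

section \<open>Tails from moments, and expectations of independent products\<close>

context prob_space
begin

text \<open>The event is enclosed in one about the trace that dominates the power of the spectral
  norm, and Markov's inequality is applied to that trace.\<close>

lemma spectral_norm_tail:
  fixes W :: "'a \<Rightarrow> complex ^ 'n ^ 'n"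
  assumes p: "0 < p" and W: "W \<in> bounded_rv" and a: "0 < a"
  shows "prob {\<omega> \<in> space M. a \<le> spectral_norm (W \<omega>)} \<le> moment p W / a ^ (2 * p)"
proof -
  let ?f = "\<lambda>\<omega>. re_trace (mprod (alternating fadj (2 * p) (fadj W)) \<omega>)"
  have int: "integrable M ?f"
    using W by (intro integrable_re_trace bounded_rv_mprod bounded_rv_alternating) auto
  then have [measurable]: "?f \<in> borel_measurable M" by auto
  have "prob {\<omega> \<in> space M. a \<le> spectral_norm (W \<omega>)} \<le> prob {\<omega> \<in> space M. a ^ (2 * p) \<le> ?f \<omega>}"
  proof (rule finite_measure_mono)
    show "{\<omega> \<in> space M. a \<le> spectral_norm (W \<omega>)} \<subseteq> {\<omega> \<in> space M. a ^ (2 * p) \<le> ?f \<omega>}"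
      using a spectral_norm_power_le[OF p, of W] power_mono[of a _ "2 * p"]
      by (auto intro: order_trans less_imp_le)
  qed simp
  also have "\<dots> \<le> expectation ?f / a ^ (2 * p)"
    using int a
    by (intro integral_Markov_inequality_measure[where A = "space M"])
       (auto simp: mprod_alternating_double re_trace_adj_mult)
  also have "expectation ?f = moment p W"
    by (simp add: moment_fadj[of p W, symmetric]) (simp add: moment_def expected_trace_def)
  finally show ?thesis .
qed

text \<open>Each entry of the product is a sum of products of independent scalars, so the scalar
  product rule applies entrywise.\<close>

lemma indep_var_expectation_mult:
  fixes U V :: "'a \<Rightarrow> complex ^ 'n ^ 'n"
  assumes U: "U \<in> bounded_rv" and V: "V \<in> bounded_rv" and ind: "indep_var borel U borel V"
  shows "expectation (\<lambda>\<omega>. U \<omega> ** V \<omega>) = expectation U ** expectation V"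
proof -
  have bl: "bounded_linear (\<lambda>A :: complex ^ 'n ^ 'n. A $ i $ j)" for i j
    by (rule bounded_linear_compose[OF bounded_linear_vec_nth bounded_linear_vec_nth])
  have entry: "expectation W $ i $ j = expectation (\<lambda>\<omega>. W \<omega> $ i $ j)"
    and int: "integrable M (\<lambda>\<omega>. W \<omega> $ i $ j)"
    if "W \<in> bounded_rv" for W :: "'a \<Rightarrow> complex ^ 'n ^ 'n" and i j
    using integral_bounded_linear[OF bl integrable_bounded_rv[OF that]]
      integrable_bounded_linear[OF bl integrable_bounded_rv[OF that]] by simp_all
  have meas: "(\<lambda>A :: complex ^ 'n ^ 'n. A $ i $ j) \<in> borel_measurable borel" for i j
    by (rule borel_measurable_continuous_onI[OF linear_continuous_on[OF bl]])
  have ind': "indep_var borel (\<lambda>\<omega>. U \<omega> $ i $ k) borel (\<lambda>\<omega>. V \<omega> $ k $ j)" for i j k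
    using indep_var_compose[OF ind meas meas] by (simp add: o_def)
  have prod: "expectation (\<lambda>\<omega>. U \<omega> $ i $ k * V \<omega> $ k $ j) = expectation U $ i $ k * expectation V $ k $ j"
    and int2: "integrable M (\<lambda>\<omega>. U \<omega> $ i $ k * V \<omega> $ k $ j)" for i j k
    using indep_var_lebesgue_integral[OF ind' int[OF U] int[OF V]]
      indep_var_integrable[OF ind' int[OF U] int[OF V]] by (simp_all add: entry U V)
  show ?thesis
    unfolding vec_eq_iff
  proof (intro allI)
    fix i j
    have "expectation (\<lambda>\<omega>. U \<omega> ** V \<omega>) $ i $ j = expectation (\<lambda>\<omega>. (U \<omega> ** V \<omega>) $ i $ j)"
      using U V by (intro entry) auto
    also have "\<dots> = (expectation U ** expectation V) $ i $ j"
      by (simp add: matrix_matrix_mult_def int2 prod)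
    finally show "expectation (\<lambda>\<omega>. U \<omega> ** V \<omega>) $ i $ j = (expectation U ** expectation V) $ i $ j" .
  qed
qed

end

section \<open>Products of independent factors\<close>

lemma borel_measurable_mprod:
  "set Ws \<subseteq> borel_measurable N \<Longrightarrow> mprod Ws \<in> borel_measurable N"
  by (induction Ws) (auto simp: mprod_def[abs_def])

lemma borel_measurable_fadj:
  "W \<in> borel_measurable N \<Longrightarrow> fadj W \<in> borel_measurable N"
  using borel_measurable_continuous_on[OF linear_continuous_on[OF bounded_linear_adj], of W N]
  by (simp add: fadj_def[abs_def])

text \<open>These are the hypotheses of the theorem with the mean written as \<open>A\<close> and
  the square removed from the deviation bound, which \<open>b > 0\<close> permits.\<close>

locale matrix_factors = prob_space M for M :: "'w measure" +
  fixes n :: nat and b :: real and A :: "complex ^ 'd ^ 'd"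
    and X :: "nat \<Rightarrow> 'w \<Rightarrow> complex ^ 'd ^ 'd"
  assumes n: "n \<ge> 1" and b: "b > 0"
    and indep: "indep_vars (\<lambda>_. borel) X {1..n}"
    and mean: "i \<in> {1..n} \<Longrightarrow> expectation (X i) = A"
    and dev: "i \<in> {1..n} \<Longrightarrow> AE \<omega> in M. spectral_norm (X i \<omega> - A) \<le> b"
begin

text \<open>The \<open>i\<close>-th factor of the product is \<open>T + \<Delta> i \<omega>\<close>,
  its mean plus a centred fluctuation.\<close>

definition "\<Delta> i \<omega> = (X i \<omega> - A) /\<^sub>R real n"

definition "T = mat 1 + A /\<^sub>R real n"

definition "Q k \<omega> = left_prod (\<lambda>i. mat 1 + X i \<omega> /\<^sub>R real n) k"

definition "growth = 1 + spectral_norm A / real n"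

lemma Q_0: "Q 0 = (\<lambda>_. mat 1)"
  by (simp add: Q_def fun_eq_iff)

lemma Q_Suc: "Q (Suc k) \<omega> = T ** Q k \<omega> + \<Delta> (Suc k) \<omega> ** Q k \<omega>"
proof -
  have "mat 1 + X (Suc k) \<omega> /\<^sub>R real n = T + \<Delta> (Suc k) \<omega>"
    by (simp add: T_def \<Delta>_def scaleR_diff_right)
  then show ?thesis by (simp add: Q_def matrix_mult_add_rdistrib)
qed

text \<open>Multiplying by the identity matrix converts the spectral bound \<open>dev\<close> into
  the Frobenius bound that \<open>bounded_rv\<close> asks for.\<close>

lemma X_bounded: "i \<in> {1..n} \<Longrightarrow> X i \<in> bounded_rv"
proof -
  assume i: "i \<in> {1..n}"
  have "AE \<omega> in M. norm (X i \<omega>) \<le> norm A + b * norm (mat 1 :: complex ^ 'd ^ 'd)"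
    using dev[OF i]
  proof eventually_elim
    case (elim \<omega>)
    have "norm (X i \<omega> - A) \<le> spectral_norm (X i \<omega> - A) * norm (mat 1 :: complex ^ 'd ^ 'd)"
      using norm_matrix_mult_le[of "X i \<omega> - A" "mat 1"] by simp
    also have "\<dots> \<le> b * norm (mat 1 :: complex ^ 'd ^ 'd)"
      using elim by (intro mult_right_mono) auto
    finally show ?case
      using norm_triangle_ineq2[of "X i \<omega>" A] by simp
  qed
  moreover have "X i \<in> borel_measurable M"
    using indep i by (simp add: indep_vars_def)
  ultimately show ?thesis by (intro bounded_rvI)
qed

lemma \<Delta>_bounded: "i \<in> {1..n} \<Longrightarrow> \<Delta> i \<in> bounded_rv"
  unfolding \<Delta>_def[abs_def] by (intro bounded_rv_scaleR bounded_rv_diff X_bounded bounded_rv_const)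

lemma spectral_norm_\<Delta>:
  assumes "i \<in> {1..n}"
  shows "AE \<omega> in M. spectral_norm (\<Delta> i \<omega>) \<le> b / real n"
  using dev[OF assms] by eventually_elim (simp add: \<Delta>_def spectral_norm_scaleR divide_inverse mult.commute[of b] mult_left_mono)

lemma expectation_\<Delta>:
  assumes "i \<in> {1..n}"
  shows "expectation (\<Delta> i) = 0"
  using integrable_bounded_rv[OF X_bounded[OF assms]] mean[OF assms]
  by (simp add: \<Delta>_def[abs_def] prob_space)

lemma growth_ge_1: "1 \<le> growth"
  by (simp add: growth_def spectral_norm_nonneg)

lemma spectral_norm_T: "spectral_norm T \<le> growth"
  using spectral_norm_triangle[of "mat 1" "A /\<^sub>R real n"] spectral_norm_mat_1_le
  by (auto simp: T_def growth_def spectral_norm_scaleR divide_inverse mult.commute intro: order_trans)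

lemma Q_bounded: "k \<le> n \<Longrightarrow> Q k \<in> bounded_rv"
proof (induction k)
  case (Suc k)
  then show ?case
    unfolding Q_Suc[abs_def]
    by (intro bounded_rv_add bounded_rv_mult bounded_rv_const \<Delta>_bounded) auto
qed (simp add: Q_0)

text \<open>\<open>Q k\<close> is a measurable function of the factors with index in
  \<open>{1..k}\<close>, a block disjoint from \<open>{Suc k}\<close>.\<close>

lemma indep_X_Q:
  assumes "k < n"
  shows "indep_var borel (X (Suc k)) borel (Q k)"
proof -
  define f where "f j x = left_prod (\<lambda>i. mat 1 + x i /\<^sub>R real n) j" for j and x :: "nat \<Rightarrow> complex ^ 'd ^ 'd"
  have f_0: "f 0 = (\<lambda>_. mat 1)" by (simp add: f_def fun_eq_iff)
  have f_Suc: "f (Suc j) = (\<lambda>x. (mat 1 + x (Suc j) /\<^sub>R real n) ** f j x)" for j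
    by (simp add: f_def fun_eq_iff)
  have meas: "f j \<in> borel_measurable (PiM {1..k} (\<lambda>_. borel))" if "j \<le> k" for j
    using that
  proof (induction j)
    case (Suc j)
    then have "(\<lambda>x. x (Suc j)) \<in> borel_measurable (PiM {1..k} (\<lambda>_. borel :: (complex ^ 'd ^ 'd) measure))"
      by (intro measurable_component_singleton) auto
    then have "(\<lambda>x. (mat 1 + x (Suc j) /\<^sub>R real n) ** f j x) \<in> borel_measurable (PiM {1..k} (\<lambda>_. borel))"
      using Suc by (intro borel_measurable_matrix_mult) auto
    then show ?case unfolding f_Suc .
  qed (simp add: f_0)
  have f_restrict: "f j (restrict (\<lambda>i. X i \<omega>) {1..k}) = Q j \<omega>" if "j \<le> k" for j \<omega>
    using that by (induction j) (auto simp: f_def Q_def)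
  have "indep_var (PiM {Suc k} (\<lambda>_. borel)) (\<lambda>\<omega>. restrict (\<lambda>i. X i \<omega>) {Suc k})
      (PiM {1..k} (\<lambda>_. borel)) (\<lambda>\<omega>. restrict (\<lambda>i. X i \<omega>) {1..k})"
    using assms by (intro indep_var_restrict[OF indep]) auto
  from indep_var_compose[OF this, of "\<lambda>x. x (Suc k)" borel "f k" borel] show ?thesis
    using meas[of k] by (simp add: o_def f_restrict measurable_component_singleton del: One_nat_def)
qed

text \<open>The next fluctuation has mean zero given the past; this is stated through functions of
  \<open>Q k\<close> instead of a conditional expectation.\<close>

lemma expectation_\<Delta>_mult:
  assumes k: "k < n" and f: "f \<in> borel_measurable borel" "(\<lambda>\<omega>. f (Q k \<omega>)) \<in> bounded_rv"
  shows "expectation (\<lambda>\<omega>. \<Delta> (Suc k) \<omega> ** f (Q k \<omega>)) = 0"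
proof -
  have "indep_var borel (\<Delta> (Suc k)) borel (\<lambda>\<omega>. f (Q k \<omega>))"
    using indep_var_compose[OF indep_X_Q[OF k], of "\<lambda>x. (x - A) /\<^sub>R real n" borel f borel] f(1)
    by (simp add: o_def \<Delta>_def[abs_def])
  then show ?thesis
    using k \<Delta>_bounded[of "Suc k"] expectation_\<Delta>[of "Suc k"] f(2)
    by (simp add: indep_var_expectation_mult)
qed

text \<open>Everything to the right of \<open>\<Delta> (Suc k)\<close> is a measurable function
  \<open>g\<close> of \<open>Q k\<close>, so the mean vanishes. This supplies the hypothesis
  \<open>orth\<close> of \<open>schatten_smooth\<close>.\<close>

lemma orthogonal:
  assumes k: "k < n" and f: "f \<in> borel_measurable borel" "(\<lambda>\<omega>. f (Q k \<omega>)) \<in> bounded_rv"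
  shows "expected_trace (mprod ((\<lambda>\<omega>. \<Delta> (Suc k) \<omega> ** Q k \<omega>) # alternating fadj m (fadj (\<lambda>\<omega>. f (Q k \<omega>))))) = 0"
    (is "expected_trace (mprod (_ # ?R)) = 0")
proof -
  define g where "g z = z ** mprod (alternating fadj m (fadj f)) z" for z
  have R: "?R = map (\<lambda>W \<omega>. W (Q k \<omega>)) (alternating fadj m (fadj f))"
    by (auto simp: alternating_def fadj_def[abs_def])
  have "set (alternating fadj m (fadj f)) \<subseteq> borel_measurable borel"
    using set_alternating_subset[of fadj m "fadj f"] f(1) borel_measurable_fadj[OF f(1)] by auto
  then have g_meas: "g \<in> borel_measurable borel"
    unfolding g_def[abs_def] by (intro borel_measurable_matrix_mult borel_measurable_mprod) auto
  have gR: "g (Q k \<omega>) = mprod (Q k # ?R) \<omega>" for \<omega>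
    unfolding R mprod_Cons mprod_map_comp g_def ..
  have "set (Q k # ?R) \<subseteq> bounded_rv"
    using Q_bounded[of k] k bounded_rv_alternating[OF bounded_rv_fadj[OF f(2)], of m] by simp
  then have g_bdd: "(\<lambda>\<omega>. g (Q k \<omega>)) \<in> bounded_rv"
    unfolding gR by (rule bounded_rv_mprod)
  have "mprod ((\<lambda>\<omega>. \<Delta> (Suc k) \<omega> ** Q k \<omega>) # ?R) = (\<lambda>\<omega>. \<Delta> (Suc k) \<omega> ** g (Q k \<omega>))"
    unfolding fun_eq_iff gR mprod_Cons matrix_mul_assoc by simp
  then have "expected_trace (mprod ((\<lambda>\<omega>. \<Delta> (Suc k) \<omega> ** Q k \<omega>) # ?R)) =
      expectation (\<lambda>\<omega>. re_trace (\<Delta> (Suc k) \<omega> ** g (Q k \<omega>)))"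
    by (simp only: expected_trace_def)
  also have "\<dots> = re_trace (expectation (\<lambda>\<omega>. \<Delta> (Suc k) \<omega> ** g (Q k \<omega>)))"
    using k g_bdd \<Delta>_bounded[of "Suc k"]
    by (intro integral_bounded_linear bounded_linear_re_trace integrable_bounded_rv bounded_rv_mult) auto
  also have "\<dots> = 0"
    using expectation_\<Delta>_mult[OF k g_meas g_bdd]
    by (simp add: linear_0[OF bounded_linear.linear[OF bounded_linear_re_trace]])
  finally show ?thesis .
qed

text \<open>One step of both recursions: \<open>f\<close> is the identity for \<open>Q\<close>
  itself and subtraction of the mean for the centred product. In both cases the fluctuation
  multiplies the uncentred \<open>Q k\<close>.\<close>

lemma schatten_step:
  assumes p: "0 < p" and k: "k < n"
    and f: "f \<in> borel_measurable borel" "(\<lambda>\<omega>. f (Q k \<omega>)) \<in> bounded_rv"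
  shows "(schatten p (\<lambda>\<omega>. T ** f (Q k \<omega>) + \<Delta> (Suc k) \<omega> ** Q k \<omega>))\<^sup>2 \<le>
    growth\<^sup>2 * (schatten p (\<lambda>\<omega>. f (Q k \<omega>)))\<^sup>2 + (2 * real p - 1) * (b / real n)\<^sup>2 * (schatten p (Q k))\<^sup>2"
proof -
  have k1: "Suc k \<in> {1..n}" using k by simp
  have Qk: "Q k \<in> bounded_rv" using Q_bounded k by simp
  have Tf: "(\<lambda>x. T ** f x) \<in> borel_measurable borel"
    using f(1) by (intro borel_measurable_matrix_mult) auto
  have Tf_bdd: "(\<lambda>\<omega>. T ** f (Q k \<omega>)) \<in> bounded_rv"
    using f(2) by (intro bounded_rv_mult) auto
  have "(schatten p (\<lambda>\<omega>. T ** f (Q k \<omega>) + \<Delta> (Suc k) \<omega> ** Q k \<omega>))\<^sup>2 \<le>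
      (schatten p (\<lambda>\<omega>. T ** f (Q k \<omega>)))\<^sup>2 + (2 * real p - 1) * (schatten p (\<lambda>\<omega>. \<Delta> (Suc k) \<omega> ** Q k \<omega>))\<^sup>2"
    using schatten_smooth[OF p Tf_bdd bounded_rv_mult[OF \<Delta>_bounded[OF k1] Qk]]
      orthogonal[OF k Tf Tf_bdd] by simp
  also have "\<dots> \<le> (growth * schatten p (\<lambda>\<omega>. f (Q k \<omega>)))\<^sup>2 + (2 * real p - 1) * (b / real n * schatten p (Q k))\<^sup>2"
    using p growth_ge_1 spectral_norm_T b spectral_norm_\<Delta>[OF k1] \<Delta>_bounded[OF k1] Qk f(2)
    by (intro add_mono mult_left_mono power_mono schatten_mult_le schatten_nonneg) auto
  finally show ?thesis by (simp only: power_mult_distrib mult.assoc)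
qed

section \<open>Recursions for the moments of the partial products\<close>

definition "rate p = (2 * real p - 1) * (b / real n)\<^sup>2"

lemma rate_nonneg: "0 < p \<Longrightarrow> 0 \<le> rate p"
  by (simp add: rate_def)

text \<open>Since \<open>growth\<close> is at least 1, the noise term may be multiplied by
  \<open>growth\<^sup>2\<close>, which makes the recursion geometric.\<close>

lemma schatten_Q:
  assumes p: "0 < p"
  shows "k \<le> n \<Longrightarrow> (schatten p (Q k))\<^sup>2 \<le> (growth\<^sup>2 * (1 + rate p)) ^ k * (schatten p (Q 0))\<^sup>2"
proof (induction k)
  case (Suc k)
  have "(schatten p (Q (Suc k)))\<^sup>2 \<le> growth\<^sup>2 * (schatten p (Q k))\<^sup>2 + rate p * (schatten p (Q k))\<^sup>2"
    using schatten_step[OF p, of k "\<lambda>x. x"] Suc.prems Q_bounded[of k] by (simp add: Q_Suc[abs_def] rate_def)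
  also have "\<dots> \<le> growth\<^sup>2 * (schatten p (Q k))\<^sup>2 + growth\<^sup>2 * rate p * (schatten p (Q k))\<^sup>2"
    using growth_ge_1 rate_nonneg[OF p] one_le_power[OF growth_ge_1, of 2]
    by (intro add_left_mono mult_right_mono) (auto simp: mult_le_cancel_right1)
  also have "\<dots> = (growth\<^sup>2 * (1 + rate p)) * (schatten p (Q k))\<^sup>2"
    by (simp add: algebra_simps)
  also have "\<dots> \<le> (growth\<^sup>2 * (1 + rate p)) * ((growth\<^sup>2 * (1 + rate p)) ^ k * (schatten p (Q 0))\<^sup>2)"
    using Suc rate_nonneg[OF p] by (intro mult_left_mono) auto
  finally show ?case by (simp add: mult_ac)
qed simp

lemma expectation_Q_Suc:
  assumes "k < n"
  shows "expectation (Q (Suc k)) = T ** expectation (Q k)"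
proof -
  have Qk: "Q k \<in> bounded_rv" and D: "\<Delta> (Suc k) \<in> bounded_rv"
    using assms Q_bounded \<Delta>_bounded by auto
  have bl: "bounded_linear (\<lambda>B. T ** B)"
    by (rule bounded_bilinear.bounded_linear_right[OF bounded_bilinear_matrix_mult])
  have "expectation (Q (Suc k)) = expectation (\<lambda>\<omega>. T ** Q k \<omega>) + expectation (\<lambda>\<omega>. \<Delta> (Suc k) \<omega> ** Q k \<omega>)"
    unfolding Q_Suc[abs_def] using Qk D
    by (intro Bochner_Integration.integral_add integrable_bounded_rv bounded_rv_mult) auto
  also have "expectation (\<lambda>\<omega>. \<Delta> (Suc k) \<omega> ** Q k \<omega>) = 0"
    using expectation_\<Delta>_mult[OF assms, of "\<lambda>x. x"] Qk by simp
  also have "expectation (\<lambda>\<omega>. T ** Q k \<omega>) = T ** expectation (Q k)"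
    by (rule integral_bounded_linear[OF bl integrable_bounded_rv[OF Qk]])
  finally show ?thesis by simp
qed

text \<open>With the bound of \<open>schatten_Q\<close> for the noise term, enlarged by
  \<open>growth\<^sup>2\<close>, the recursion closes because
  \<open>(1 + r) ^ k - 1 + r * (1 + r) ^ k = (1 + r) ^ Suc k - 1\<close>.\<close>

lemma schatten_Q_centered:
  assumes p: "0 < p"
  shows "k \<le> n \<Longrightarrow> (schatten p (\<lambda>\<omega>. Q k \<omega> - expectation (Q k)))\<^sup>2 \<le>
    (growth\<^sup>2) ^ k * ((1 + rate p) ^ k - 1) * (schatten p (Q 0))\<^sup>2"
proof (induction k)
  case 0
  \<comment> \<open>\<open>Q 0\<close> is deterministic, so its centred version is zero, and
    homogeneity gives it norm zero.\<close>
  have "schatten p (\<lambda>\<omega>. 0 *\<^sub>R Q 0 \<omega>) = 0"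
    by (simp only: schatten_scaleR[OF p] abs_zero mult_zero_left)
  then show ?case by (simp add: Q_0 prob_space)
next
  case (Suc k)
  let ?g = "growth\<^sup>2" and ?r = "rate p" and ?s = "(schatten p (Q 0))\<^sup>2"
  have r: "0 \<le> ?r" and g: "1 \<le> ?g"
    using rate_nonneg[OF p] one_le_power[OF growth_ge_1] by auto
  have "(\<lambda>\<omega>. Q (Suc k) \<omega> - expectation (Q (Suc k))) =
      (\<lambda>\<omega>. T ** (Q k \<omega> - expectation (Q k)) + \<Delta> (Suc k) \<omega> ** Q k \<omega>)"
    using Suc.prems
    by (simp add: fun_eq_iff Q_Suc expectation_Q_Suc bounded_bilinear.diff_right[OF bounded_bilinear_matrix_mult])
  moreover have "(\<lambda>x. x - expectation (Q k)) \<in> borel_measurable borel"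
    and "(\<lambda>\<omega>. Q k \<omega> - expectation (Q k)) \<in> bounded_rv"
    using Suc.prems Q_bounded[of k] by auto
  ultimately have "(schatten p (\<lambda>\<omega>. Q (Suc k) \<omega> - expectation (Q (Suc k))))\<^sup>2 \<le>
      ?g * (schatten p (\<lambda>\<omega>. Q k \<omega> - expectation (Q k)))\<^sup>2 + ?r * (schatten p (Q k))\<^sup>2"
    using schatten_step[OF p, of k "\<lambda>x. x - expectation (Q k)"] Suc.prems by (simp add: rate_def)
  also have "\<dots> \<le> ?g * (?g ^ k * ((1 + ?r) ^ k - 1) * ?s) + ?r * (?g * ((?g * (1 + ?r)) ^ k * ?s))"
  proof (intro add_mono mult_left_mono)
    have "(schatten p (Q k))\<^sup>2 \<le> (?g * (1 + ?r)) ^ k * ?s"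
      using schatten_Q[OF p, of k] Suc.prems by simp
    also have "\<dots> \<le> ?g * ((?g * (1 + ?r)) ^ k * ?s)"
      using g r mult_right_mono[OF g, of "(?g * (1 + ?r)) ^ k * ?s"] by simp
    finally show "(schatten p (Q k))\<^sup>2 \<le> ?g * ((?g * (1 + ?r)) ^ k * ?s)" .
  qed (use Suc r in auto)
  also have "\<dots> = ?g ^ Suc k * ((1 + ?r) ^ Suc k - 1) * ?s"
    by (simp add: power_mult_distrib) (simp add: algebra_simps)
  finally show ?case .
qed

text \<open>The trace of the identity is the origin of the dimension factor in both tail
  bounds.\<close>

lemma moment_Q_0: "moment p (Q 0) = real CARD('d)"
proof -
  have "mprod (alternating fadj (2 * p) (Q 0)) \<omega> = mat 1" for \<omega>
  proof -
    have "\<forall>W\<in>set Ws. W = (\<lambda>_. mat 1) \<Longrightarrow> mprod Ws \<omega> = mat 1" for Ws :: "('w \<Rightarrow> complex ^ 'd ^ 'd) list"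
      by (induction Ws) auto
    moreover have "fadj (Q 0) = Q 0" by (simp add: Q_0 fadj_def[abs_def])
    ultimately show ?thesis
      using set_alternating_subset[of fadj "2 * p" "Q 0"] by (auto simp: Q_0)
  qed
  then show ?thesis by (simp add: moment_def expected_trace_def re_trace_mat_1 prob_space)
qed

lemma growth_power_le: "(growth\<^sup>2) ^ n \<le> exp (spectral_norm A) ^ 2"
proof -
  have "growth ^ n \<le> exp (spectral_norm A / real n) ^ n"
    using growth_ge_1 exp_ge_add_one_self[of "spectral_norm A / real n"] by (intro power_mono) (auto simp: growth_def)
  also have "\<dots> = exp (spectral_norm A)"
    using n by (simp add: exp_of_nat_mult[symmetric])
  finally have "(growth ^ n)\<^sup>2 \<le> (exp (spectral_norm A))\<^sup>2"
    using growth_ge_1 by (intro power_mono) auto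
  then show ?thesis by (simp add: power_mult[symmetric] mult.commute)
qed

lemma rate_power_le:
  assumes "0 < p"
  shows "(1 + rate p) ^ n \<le> exp ((2 * real p - 1) * (b\<^sup>2 / real n))"
proof -
  have "(1 + rate p) ^ n \<le> exp (rate p) ^ n"
    using rate_nonneg[OF assms] exp_ge_add_one_self[of "rate p"] by (intro power_mono) auto
  also have "\<dots> = exp ((2 * real p - 1) * (b\<^sup>2 / real n))"
    using n by (simp add: exp_of_nat_mult[symmetric] rate_def power2_eq_square)
  finally show ?thesis .
qed

lemma moment_Q_le:
  assumes p: "0 < p"
  shows "moment p (Q n) \<le> real CARD('d) * (exp (spectral_norm A) ^ (2 * p) *
    exp ((2 * real p - 1) * (b\<^sup>2 / real n)) ^ p)"
proof -
  have "moment p (Q n) = ((schatten p (Q n))\<^sup>2) ^ p"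
    by (simp add: schatten_power[OF p] power_mult[symmetric])
  also have "\<dots> \<le> ((growth\<^sup>2 * (1 + rate p)) ^ n * (schatten p (Q 0))\<^sup>2) ^ p"
    using schatten_Q[OF p, of n] by (intro power_mono) auto
  also have "\<dots> = ((growth\<^sup>2) ^ n) ^ p * ((1 + rate p) ^ n) ^ p * moment p (Q 0)"
    by (simp add: schatten_power[OF p, symmetric] power_mult_distrib power_mult)
  also have "\<dots> \<le> (exp (spectral_norm A) ^ 2) ^ p * exp ((2 * real p - 1) * (b\<^sup>2 / real n)) ^ p * moment p (Q 0)"
    using growth_power_le rate_power_le[OF p] rate_nonneg[OF p] moment_nonneg[of p "Q 0"]
    by (intro mult_right_mono mult_mono power_mono) auto
  finally show ?thesis by (simp only: moment_Q_0 power_mult mult.commute[of _ "real CARD('d)"])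
qed

lemma moment_Q_centered_le:
  assumes p: "0 < p"
  shows "moment p (\<lambda>\<omega>. Q n \<omega> - expectation (Q n)) \<le> real CARD('d) * (exp (spectral_norm A) ^ (2 * p) *
    (exp ((2 * real p - 1) * (b\<^sup>2 / real n)) - 1) ^ p)"
proof -
  have one: "1 \<le> (1 + rate p) ^ n" using rate_nonneg[OF p] by (intro one_le_power) auto
  have "moment p (\<lambda>\<omega>. Q n \<omega> - expectation (Q n)) = ((schatten p (\<lambda>\<omega>. Q n \<omega> - expectation (Q n)))\<^sup>2) ^ p"
    by (simp add: schatten_power[OF p] power_mult[symmetric])
  also have "\<dots> \<le> ((growth\<^sup>2) ^ n * ((1 + rate p) ^ n - 1) * (schatten p (Q 0))\<^sup>2) ^ p"
    using schatten_Q_centered[OF p, of n] by (intro power_mono) auto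
  also have "\<dots> = ((growth\<^sup>2) ^ n) ^ p * ((1 + rate p) ^ n - 1) ^ p * moment p (Q 0)"
    by (simp add: schatten_power[OF p, symmetric] power_mult_distrib power_mult)
  also have "\<dots> \<le> (exp (spectral_norm A) ^ 2) ^ p * (exp ((2 * real p - 1) * (b\<^sup>2 / real n)) - 1) ^ p * moment p (Q 0)"
    using growth_power_le rate_power_le[OF p] one moment_nonneg[of p "Q 0"]
    by (intro mult_right_mono mult_mono power_mono) auto
  finally show ?thesis by (simp only: moment_Q_0 power_mult mult.commute[of _ "real CARD('d)"])
qed

end

section \<open>Tail bounds\<close>

text \<open>After division by \<open>exp r\<close>, two tangent-line bounds for \<open>exp\<close>
  remain. One gives \<open>exp (2 - 1 / r - r) \<ge> 1 - (1 - r)\<^sup>2 / r\<close>; the other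
  shows that \<open>exp (- r)\<close> covers the deficit. On the given range
  \<open>q = r * (2 - r)\<close> is at least 3/4, which suffices.\<close>

lemma exp_minus_one_le:
  fixes r :: real
  assumes "1 / 2 \<le> r" "r \<le> 3 / 2"
  shows "exp r - 1 \<le> exp (2 - 1 / r)"
proof -
  have r: "0 < r" using assms by simp
  have "(1 - r)\<^sup>2 / r \<le> (2 - r) * (100 / 272)"
  proof -
    define q where "q = 2 * r - r * r"
    have "0 \<le> (r - 1 / 2) * (3 / 2 - r)" using assms by simp
    also have "\<dots> = q - 3 / 4" by (simp add: q_def field_simps)
    finally have "1 - q \<le> q * (100 / 272)" by simp
    also have "1 - q = (1 - r)\<^sup>2" by (simp add: q_def power2_eq_square algebra_simps)
    also have "q * (100 / 272) = (2 - r) * (100 / 272) * r" by (simp add: q_def algebra_simps)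
    finally have "(1 - r)\<^sup>2 \<le> (2 - r) * (100 / 272) * r" .
    then show ?thesis using r by (simp add: pos_divide_le_eq)
  qed
  also have "\<dots> \<le> exp (1 - r) * exp (- 1)"
  proof (intro mult_mono)
    show "2 - r \<le> exp (1 - r)" using exp_ge_add_one_self[of "1 - r"] by simp
    \<comment> \<open>This is \<open>exp 1 < 2.72\<close>, inverted.\<close>
    show "100 / 272 \<le> exp (- 1 :: real)"
      using e_less_272 by (simp add: exp_minus field_simps)
  qed (use assms in auto)
  also have "\<dots> = exp (- r)" by (simp add: exp_add[symmetric])
  finally have "(1 - r)\<^sup>2 / r \<le> exp (- r)" .
  moreover have "3 - 1 / r - r \<le> exp (2 - 1 / r - r)"
    using exp_ge_add_one_self[of "2 - 1 / r - r"] by simp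
  moreover have "(1 - r)\<^sup>2 / r + (3 - 1 / r - r) = 1"
    using r by (simp add: power2_eq_square field_simps)
  ultimately have "1 \<le> exp (- r) + exp (2 - 1 / r - r)" by linarith
  from mult_left_mono[OF this, of "exp r"] have "exp r \<le> 1 + exp (2 - 1 / r)"
    by (simp add: distrib_left exp_add[symmetric])
  then show ?thesis by simp
qed

lemma exp_mult_minus_one_le:
  fixes r w :: real
  assumes "0 \<le> w" "w \<le> 1"
  shows "exp (r * w) - 1 \<le> w * (exp r - 1)"
proof -
  have "exp ((1 - w) *\<^sub>R 0 + w *\<^sub>R r) \<le> (1 - w) * exp 0 + w * exp r"
    by (rule convex_onD[OF exp_convex]) (use assms in auto)
  then show ?thesis by (simp add: algebra_simps)
qed

lemma obtain_half_exponent: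
  fixes u :: real
  assumes "0 \<le> u"
  obtains p :: nat where "0 < p" "u < 2 * real p" "2 * real p \<le> u + 2"
proof
  show "0 < nat \<lfloor>u / 2\<rfloor> + 1" by simp
  have "real (nat \<lfloor>u / 2\<rfloor> + 1) = of_int \<lfloor>u / 2\<rfloor> + 1" using assms by simp
  moreover have "2 * of_int \<lfloor>u / 2\<rfloor> \<le> u" "u < 2 * of_int \<lfloor>u / 2\<rfloor> + 2" by linarith+
  ultimately show "u < 2 * real (nat \<lfloor>u / 2\<rfloor> + 1)" "2 * real (nat \<lfloor>u / 2\<rfloor> + 1) \<le> u + 2"
    by simp_all
qed

text \<open>The quadratic \<open>v * q\<^sup>2 / 2 - q * L\<close> is least at
  \<open>q = u = L / v\<close>. Rounding to \<open>q = 2 * p = u + x\<close> with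
  \<open>0 < x \<le> 2\<close> costs \<open>v * x\<^sup>2 / 2\<close>, and having
  \<open>q * (q - 1)\<close> in place of \<open>q\<^sup>2\<close> gains
  \<open>v * (u + x) / 2\<close>. The gain is sufficient because \<open>u \<ge> 2\<close>.\<close>

lemma growth_exponent_le:
  fixes L v :: real
  assumes v: "0 < v" and L: "2 * v \<le> L"
  obtains p :: nat where "0 < p" "(2 * real p - 1) * v * real p - 2 * real p * L \<le> - (L\<^sup>2 / (2 * v))"
proof -
  define u where "u = L / v"
  have u: "2 \<le> u" using assms by (simp add: u_def field_simps)
  have Lu: "L = u * v" using v by (simp add: u_def)
  obtain p :: nat where p: "0 < p" "u < 2 * real p" "2 * real p \<le> u + 2"
    using obtain_half_exponent[of u] u by auto
  define x where "x = 2 * real p - u"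
  have "0 \<le> (2 - x) * (1 + x)" using p by (simp add: x_def)
  then have "x * x \<le> u + x" using u by (simp add: algebra_simps)
  then have "v * (x * x) \<le> v * (u + x)" using v by (intro mult_left_mono) auto
  moreover have "(2 * real p - 1) * v * real p - 2 * real p * L + L\<^sup>2 / (2 * v) = (v * (x * x) - v * (u + x)) / 2"
  proof -
    have p_eq: "real p = (u + x) / 2" by (simp add: x_def)
    have L_eq: "L\<^sup>2 / (2 * v) = u * u * v / 2" using v by (simp add: Lu power2_eq_square)
    show ?thesis unfolding L_eq p_eq unfolding Lu by (simp add: field_simps)
  qed
  ultimately have "(2 * real p - 1) * v * real p - 2 * real p * L + L\<^sup>2 / (2 * v) \<le> 0"
    by (simp only:) simp
  then have "(2 * real p - 1) * v * real p - 2 * real p * L \<le> - (L\<^sup>2 / (2 * v))"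
    by (simp only: le_minus_iff[of _ "L\<^sup>2 / (2 * v)"] minus_le_iff add_eq_0_iff)
  with p(1) show ?thesis by (rule that)
qed

text \<open>With \<open>w = u * v = t\<^sup>2 / (exp 1)\<^sup>2 \<le> 1\<close> and
  \<open>r = (2 * p - 1) / u\<close>, the exponent is \<open>r * w\<close>, and convexity pulls out
  \<open>w\<close>. Since \<open>u \<ge> 2\<close>, rounding keeps \<open>r\<close> between 1/2 and
  3/2, so \<open>exp_minus_one_le\<close> bounds the base by \<open>exp (- (1 / r))\<close>; finally
  \<open>p / r \<ge> u / 2\<close>.\<close>

lemma deviation_exponent_le:
  fixes t v u :: real
  assumes v: "0 < v" and t: "0 < t" "t \<le> exp 1" and u: "u = t\<^sup>2 / ((exp 1)\<^sup>2 * v)" "2 \<le> u"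
  obtains p :: nat where "0 < p" "((exp ((2 * real p - 1) * v) - 1) / t\<^sup>2) ^ p \<le> exp (- (u / 2))"
proof -
  obtain p :: nat where p: "0 < p" "u < 2 * real p" "2 * real p \<le> u + 2"
    using obtain_half_exponent[of u] u(2) by auto
  define r w where "r = (2 * real p - 1) / u" and "w = u * v"
  have tw: "t\<^sup>2 = (exp 1)\<^sup>2 * w" using v by (simp add: u(1) w_def)
  have "t\<^sup>2 \<le> (exp 1)\<^sup>2" using t by (intro power_mono) auto
  then have w: "0 < w" "w \<le> 1" using u(2) v by (simp_all add: tw) (simp add: w_def)
  have r: "1 / 2 \<le> r" "r \<le> 3 / 2"
    using p u(2) by (simp_all add: r_def field_simps)
  have "exp ((2 * real p - 1) * v) - 1 = exp (r * w) - 1"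
    using u(2) by (simp add: r_def w_def)
  also have "\<dots> \<le> w * exp (2 - 1 / r)"
    using exp_mult_minus_one_le[of w r] exp_minus_one_le[OF r] w
    by (meson less_imp_le mult_left_mono order_trans)
  finally have "(exp ((2 * real p - 1) * v) - 1) / t\<^sup>2 \<le> w * exp (2 - 1 / r) / t\<^sup>2"
    by (intro divide_right_mono) auto
  also have "\<dots> = exp (- (1 / r))"
  proof -
    have "(exp 1 :: real)\<^sup>2 = exp 2" using exp_of_nat_mult[of 2 "1 :: real"] by simp
    moreover have "exp (2 - 1 / r) = exp 2 * exp (- (1 / r))" by (simp add: exp_add[symmetric])
    ultimately show ?thesis using w by (simp add: tw)
  qed
  finally have "((exp ((2 * real p - 1) * v) - 1) / t\<^sup>2) ^ p \<le> exp (- (1 / r)) ^ p"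
    using v p(1) by (intro power_mono) auto
  also have "\<dots> = exp (- (real p / r))"
    by (simp add: exp_of_nat_mult[symmetric])
  also have "\<dots> \<le> exp (- (u / 2))"
    using p u(2) by (simp add: r_def field_simps)
  finally show ?thesis using p(1) that by blast
qed

section \<open>The two tail bounds for the product\<close>

context matrix_factors
begin

lemma norm_tail:
  assumes s: "0 < 1 + s" and L: "2 * (b\<^sup>2 / real n) \<le> ln (1 + s)"
  shows "prob {\<omega> \<in> space M. (1 + s) * exp (spectral_norm A) \<le> spectral_norm (Q n \<omega>)}
    \<le> real CARD('d) * exp (- ((ln (1 + s))\<^sup>2 / (2 * (b\<^sup>2 / real n))))"
proof -
  let ?L = "ln (1 + s)" and ?v = "b\<^sup>2 / real n" and ?E = "exp (spectral_norm A)"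
  have v: "0 < ?v" using n b by simp
  obtain p :: nat where p: "0 < p" and le: "(2 * real p - 1) * ?v * real p - 2 * real p * ?L \<le> - (?L\<^sup>2 / (2 * ?v))"
    using growth_exponent_le[OF v L] .
  have "prob {\<omega> \<in> space M. (1 + s) * ?E \<le> spectral_norm (Q n \<omega>)} \<le> moment p (Q n) / ((1 + s) * ?E) ^ (2 * p)"
    using s by (intro spectral_norm_tail p Q_bounded) auto
  also have "\<dots> \<le> (real CARD('d) * (?E ^ (2 * p) * exp ((2 * real p - 1) * ?v) ^ p)) / ((1 + s) * ?E) ^ (2 * p)"
    using s by (intro divide_right_mono moment_Q_le p) auto
  also have "\<dots> = real CARD('d) * (exp ((2 * real p - 1) * ?v) ^ p / (1 + s) ^ (2 * p))"
    by (simp add: power_mult_distrib)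
  also have "(1 + s) ^ (2 * p) = exp (2 * real p * ?L)"
    using s exp_of_nat_mult[of "2 * p" ?L] by simp
  also have "exp ((2 * real p - 1) * ?v) ^ p = exp ((2 * real p - 1) * ?v * real p)"
    by (simp only: exp_of_nat_mult[symmetric] mult.commute[of "real p"])
  also have "exp ((2 * real p - 1) * ?v * real p) / exp (2 * real p * ?L) =
      exp ((2 * real p - 1) * ?v * real p - 2 * real p * ?L)"
    by (simp only: exp_diff)
  also have "\<dots> \<le> exp (- (?L\<^sup>2 / (2 * ?v)))" using le by simp
  finally show ?thesis by (simp add: mult_left_mono)
qed

lemma deviation_tail:
  assumes t: "0 \<le> t" "t \<le> exp 1"
  shows "prob {\<omega> \<in> space M. t * exp (spectral_norm A) \<le> spectral_norm (Q n \<omega> - expectation (Q n))}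
    \<le> (real CARD('d) + exp 1) * exp (- (t\<^sup>2 / ((exp 1)\<^sup>2 * (b\<^sup>2 / real n)) / 2))"
proof -
  let ?v = "b\<^sup>2 / real n" and ?E = "exp (spectral_norm A)"
  define u where "u = t\<^sup>2 / ((exp 1)\<^sup>2 * ?v)"
  have v: "0 < ?v" using n b by simp
  show ?thesis
  proof (cases "u \<le> 2")
    case True
    \<comment> \<open>For \<open>u \<le> 2\<close> the summand \<open>exp 1\<close> alone makes the
      right-hand side at least 1, so the bound is trivial; for larger \<open>u\<close> the dimension
      term suffices.\<close>
    have "1 = exp 1 * exp (- 1 :: real)" by (simp add: exp_minus)
    also have "\<dots> \<le> (real CARD('d) + exp 1) * exp (- (u / 2))"
      using True by (intro mult_mono) auto
    finally show ?thesis
      using prob_le_1 order_trans unfolding u_def by blast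
  next
    case False
    then have t0: "0 < t" using t by (cases "t = 0") (auto simp: u_def)
    obtain p :: nat where p: "0 < p" and le: "((exp ((2 * real p - 1) * ?v) - 1) / t\<^sup>2) ^ p \<le> exp (- (u / 2))"
      using deviation_exponent_le[OF v t0 t(2) u_def] False by auto
    have "prob {\<omega> \<in> space M. t * ?E \<le> spectral_norm (Q n \<omega> - expectation (Q n))}
        \<le> moment p (\<lambda>\<omega>. Q n \<omega> - expectation (Q n)) / (t * ?E) ^ (2 * p)"
      using t0 Q_bounded[of n] by (intro spectral_norm_tail p bounded_rv_diff) auto
    also have "\<dots> \<le> (real CARD('d) * (?E ^ (2 * p) * (exp ((2 * real p - 1) * ?v) - 1) ^ p)) / (t * ?E) ^ (2 * p)"
      using t0 by (intro divide_right_mono moment_Q_centered_le p) auto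
    also have "\<dots> = real CARD('d) * ((exp ((2 * real p - 1) * ?v) - 1) / t\<^sup>2) ^ p"
      by (simp add: power_mult_distrib power_divide power_mult)
    also have "\<dots> \<le> (real CARD('d) + exp 1) * exp (- (u / 2))"
      using le by (intro mult_mono') (use v p in auto)
    finally show ?thesis unfolding u_def .
  qed
qed

end

theorem theorem1:
  fixes M :: "'w measure"
    and n :: nat
    and b :: real
    and A :: "complex ^ 'd ^ 'd"
    and X :: "nat \<Rightarrow> 'w \<Rightarrow> complex ^ 'd ^ 'd"
    and \<mu> :: real
    and Z :: "'w \<Rightarrow> complex ^ 'd ^ 'd"
  assumes "prob_space M"
    and "n \<ge> 1"
    and "b > 0"
    and "prob_space.indep_vars M (\<lambda>_. borel) X {1..n}"
    and "\<And>i. i \<in> {1..n} \<Longrightarrow> prob_space.expectation M (X i) = A"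
    and "\<And>i. i \<in> {1..n} \<Longrightarrow>
           AE \<omega> in M. (spectral_norm (X i \<omega> - prob_space.expectation M (X i)))\<^sup>2 \<le> b\<^sup>2"
  defines "\<mu> \<equiv> spectral_norm A"
    and "Z \<equiv> perturbed_prod X n"
  shows "(\<forall>s::real. 1 + s > 0 \<and> ln (1 + s) \<ge> 2 * b\<^sup>2 / real n \<longrightarrow>
            prob_space.prob M {\<omega> \<in> space M. spectral_norm (Z \<omega>) \<ge> (1 + s) * exp \<mu>}
              \<le> real CARD('d) * exp (- (real n * (ln (1 + s))\<^sup>2) / (2 * b\<^sup>2))) \<and>
         (\<forall>t::real. 0 \<le> t \<and> t \<le> exp 1 \<longrightarrow>
            prob_space.prob M {\<omega> \<in> space M.
                spectral_norm (Z \<omega> - prob_space.expectation M Z) \<ge> t * exp \<mu>}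
              \<le> (real CARD('d) + exp 1) * exp (- (real n * t\<^sup>2) / (2 * (exp 1)\<^sup>2 * b\<^sup>2)))"
proof -
  interpret prob_space M by fact
  interpret matrix_factors M n b A X
  proof unfold_locales
    show "AE \<omega> in M. spectral_norm (X i \<omega> - A) \<le> b" if "i \<in> {1..n}" for i
      using assms(6)[OF that] unfolding assms(5)[OF that]
      by eventually_elim (use assms(3) in \<open>auto intro: power2_le_imp_le\<close>)
  qed (use assms in auto)
  have Z: "Z = Q n"
    by (simp add: Z_def Q_def perturbed_prod_def fun_eq_iff)
  have exponents: "- (x\<^sup>2 / (2 * (b\<^sup>2 / real n))) = - (real n * x\<^sup>2) / (2 * b\<^sup>2)"
    "- (x\<^sup>2 / ((exp 1)\<^sup>2 * (b\<^sup>2 / real n)) / 2) = - (real n * x\<^sup>2) / (2 * (exp 1)\<^sup>2 * b\<^sup>2)" for x :: real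
    using assms(2,3) by (simp_all add: field_simps)
  show ?thesis
    using norm_tail deviation_tail unfolding Z \<mu>_def exponents by simp
qed

end
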